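(* Let $R$ be a commutative Noetherian ring, $I$ an ideal of $R$ and $M$ a finitely generated $R$-module. Suppose $\operatorname{grade}(I,M)>0$ and $\operatorname{ann} M=0$. Then $\mathcal{F}^I_M=\{r(I^n,M)\}_{n\geq 0}$ is a stable $I$-filtration.
   Context: For submodules $A,B$ of $M$, $(A:B)=\{x\in R : xB\subseteq A\}$, and for an ideal $L$ of $R$, $r(L,M)=\bigcup_{k\geq 1}(L^{k+1}M:L^kM)$ (an ascending union of ideals). For $n\ge1$, $r(I^n,M)=\bigcup_{k\geq 1}(I^{n+k}M:I^kM)$, and $r(I^0,M)=R$. The condition $\operatorname{grade}(I,M)>0$ means that $I$ contains a nonzerodivisor on $M$. A filtration of ideals $R=I_0\supseteq I_1\supseteq I_2\supseteq\cdots$ is a stable $I$-filtration if $I\,I_n\subseteq I_{n+1}$ for all $n\geq 0$ and $I\,I_n=I_{n+1}$ for all $n\gg 0$. *)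

theory Defs
  imports "HOL-Algebra.Algebra"
begin

definition module_finitely_generated ::
    "('a, 'r) ring_scheme \<Rightarrow> ('a, 'b, 'm) module_scheme \<Rightarrow> bool" where
  "module_finitely_generated R M \<longleftrightarrow>
     (\<exists>S. finite S \<and> S \<subseteq> carrier M \<and>
        (\<forall>m\<in>carrier M. \<exists>c\<in>S \<rightarrow> carrier R. m = (\<Oplus>\<^bsub>M\<^esub>s\<in>S. c s \<odot>\<^bsub>M\<^esub> s)))"

definition module_annihilator ::
    "('a, 'r) ring_scheme \<Rightarrow> ('a, 'b, 'm) module_scheme \<Rightarrow> 'a set" where
  "module_annihilator R M = {x \<in> carrier R. \<forall>m\<in>carrier M. x \<odot>\<^bsub>M\<^esub> m = \<zero>\<^bsub>M\<^esub>}"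

definition nonzerodivisor_on ::
    "('a, 'r) ring_scheme \<Rightarrow> ('a, 'b, 'm) module_scheme \<Rightarrow> 'a \<Rightarrow> bool" where
  "nonzerodivisor_on R M x \<longleftrightarrow>
     x \<in> carrier R \<and> (\<forall>m\<in>carrier M. x \<odot>\<^bsub>M\<^esub> m = \<zero>\<^bsub>M\<^esub> \<longrightarrow> m = \<zero>\<^bsub>M\<^esub>)"

definition grade_pos ::
    "('a, 'r) ring_scheme \<Rightarrow> 'a set \<Rightarrow> ('a, 'b, 'm) module_scheme \<Rightarrow> bool" where
  "grade_pos R I M \<longleftrightarrow> (\<exists>x\<in>I. nonzerodivisor_on R M x)"

definition module_colon ::
    "('a, 'r) ring_scheme \<Rightarrow> ('a, 'b, 'm) module_scheme \<Rightarrow> 'b set \<Rightarrow> 'b set \<Rightarrow> 'a set" where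
  "module_colon R M A B = {x \<in> carrier R. \<forall>b\<in>B. x \<odot>\<^bsub>M\<^esub> b \<in> A}"

text \<open>The submodule \<open>L N\<close>: finite sums of products, generated in the same way as
  the product of ideals \<^const>\<open>ideal_prod\<close>.\<close>

inductive_set ideal_smult :: "('a, 'b, 'm) module_scheme \<Rightarrow> 'a set \<Rightarrow> 'b set \<Rightarrow> 'b set"
  for M and L and N where
    prod: "\<lbrakk> a \<in> L; m \<in> N \<rbrakk> \<Longrightarrow> a \<odot>\<^bsub>M\<^esub> m \<in> ideal_smult M L N"
  | sum: "\<lbrakk> s \<in> ideal_smult M L N; t \<in> ideal_smult M L N \<rbrakk> \<Longrightarrow> s \<oplus>\<^bsub>M\<^esub> t \<in> ideal_smult M L N"

text \<open>Powers in the monoid of ideals, so that \<open>L\<^sup>0\<close> is the whole ring.\<close>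

abbreviation ideal_pow :: "('a, 'r) ring_scheme \<Rightarrow> 'a set \<Rightarrow> nat \<Rightarrow> 'a set" where
  "ideal_pow R L n \<equiv> L [^]\<^bsub>ideals_set R\<^esub> n"

definition ratliff_rush ::
    "('a, 'r) ring_scheme \<Rightarrow> ('a, 'b, 'm) module_scheme \<Rightarrow> 'a set \<Rightarrow> 'a set" where
  "ratliff_rush R M L =
     (\<Union>k\<in>{1..}. module_colon R M (ideal_smult M (ideal_pow R L (k + 1)) (carrier M))
                                  (ideal_smult M (ideal_pow R L k) (carrier M)))"

text \<open>The definition of \<open>r(L, M)\<close> at \<open>L = I\<^sup>n\<close> uses the powers \<open>(I\<^sup>n)\<^sup>k\<close>.  The lemmas
  \<open>ratliff_rush_pow\<close> and \<open>ratliff_rush_pow_0\<close> show that it agrees with the usual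
  descriptions: the union of \<open>(I\<^sup>n\<^sup>+\<^sup>k M : I\<^sup>k M)\<close> over \<open>k \<ge> 1\<close> for \<open>n \<ge> 1\<close>, and the
  whole ring for \<open>n = 0\<close>.\<close>

lemma (in module) ideal_smult_closed:
  assumes "L \<subseteq> carrier R" "N \<subseteq> carrier M" "x \<in> ideal_smult M L N"
  shows "x \<in> carrier M"
  using assms(3) by induction (use assms in auto)

lemma (in module) ideal_smult_left:
  assumes "a \<in> carrier R" "L \<subseteq> carrier R" "N \<subseteq> carrier M"
    and "\<And>l. l \<in> L \<Longrightarrow> a \<otimes> l \<in> K" "x \<in> ideal_smult M L N"
  shows "a \<odot>\<^bsub>M\<^esub> x \<in> ideal_smult M K N"
  using assms(5)
proof induction
  case (prod l m)
  then have "a \<odot>\<^bsub>M\<^esub> (l \<odot>\<^bsub>M\<^esub> m) = (a \<otimes> l) \<odot>\<^bsub>M\<^esub> m"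
    using assms by (intro smult_assoc1 [symmetric]) auto
  then show ?case
    using prod assms(4) by (auto intro: ideal_smult.prod)
next
  case (sum s t)
  then have "s \<in> carrier M" "t \<in> carrier M"
    using ideal_smult_closed assms by blast+
  then show ?case
    using sum assms(1) by (simp add: smult_r_distr ideal_smult.sum)
qed

lemma (in module) ideal_smult_prod:
  assumes L: "ideal L R" and J: "ideal J R"
  shows "ideal_smult M (L \<cdot>\<^bsub>R\<^esub> J) (carrier M) = ideal_smult M L (ideal_smult M J (carrier M))"
proof -
  have Lc: "L \<subseteq> carrier R" and Jc: "J \<subseteq> carrier R"
    using L J by (auto dest: ideal.Icarr)
  have "x \<in> ideal_smult M L (ideal_smult M J (carrier M))"
    if "c \<in> L \<cdot>\<^bsub>R\<^esub> J" "m \<in> carrier M" "x = c \<odot>\<^bsub>M\<^esub> m" for c m x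
    using that
  proof (induction arbitrary: x)
    case (prod i j)
    then have "x = i \<odot>\<^bsub>M\<^esub> (j \<odot>\<^bsub>M\<^esub> m)"
      using Lc Jc smult_assoc1[of i j m] by blast
    then show ?case
      using prod by (auto intro!: ideal_smult.prod)
  next
    case (sum s t)
    have "s \<in> carrier R" "t \<in> carrier R"
      using sum ideal_prod_in_carrier[OF L J] by auto
    then have "x = s \<odot>\<^bsub>M\<^esub> m \<oplus>\<^bsub>M\<^esub> t \<odot>\<^bsub>M\<^esub> m"
      using sum by (simp add: smult_l_distr)
    then show ?case
      using sum by (auto intro!: ideal_smult.sum)
  qed
  note generator = this
  have A: "x \<in> ideal_smult M L (ideal_smult M J (carrier M))"
    if "x \<in> ideal_smult M (L \<cdot>\<^bsub>R\<^esub> J) (carrier M)" for x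
    using that
  proof induction
    case (prod c m)
    then show ?case by (rule generator) simp
  qed (rule ideal_smult.sum)
  have B: "x \<in> ideal_smult M (L \<cdot>\<^bsub>R\<^esub> J) (carrier M)"
    if "x \<in> ideal_smult M L (ideal_smult M J (carrier M))" for x
    using that
  proof induction
    case (prod a m)
    then show ?case
      using Lc Jc ideal_smult_left[of a J "carrier M" "L \<cdot>\<^bsub>R\<^esub> J" m]
      by (auto intro: ideal_prod.prod)
  qed (rule ideal_smult.sum)
  show ?thesis using A B by blast
qed

lemma (in cring) ideal_pow_ideal:
  assumes "ideal I R"
  shows "ideal (ideal_pow R I n) R"
  using monoid.nat_pow_closed[OF comm_monoid.axioms(1)[OF ideals_set_is_comm_monoid], of I n] assms
  by (simp add: ideals_set_def)

lemma (in cring) ideal_pow_add: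
  assumes "ideal I R"
  shows "ideal_pow R I (m + n) = ideal_pow R I m \<cdot>\<^bsub>R\<^esub> ideal_pow R I n"
  using monoid.nat_pow_mult[OF comm_monoid.axioms(1)[OF ideals_set_is_comm_monoid], of I m n] assms
  by (simp add: ideals_set_def)

lemma (in cring) ideal_pow_pow:
  assumes "ideal I R"
  shows "ideal_pow R (ideal_pow R I m) n = ideal_pow R I (m * n)"
  using monoid.nat_pow_pow[OF comm_monoid.axioms(1)[OF ideals_set_is_comm_monoid], of I m n] assms
  by (simp add: ideals_set_def)

lemma (in module) module_colon_pow_mono:
  assumes I: "ideal I R" and "k \<le> l"
  shows "module_colon R M (ideal_smult M (ideal_pow R I (n + k)) (carrier M))
                          (ideal_smult M (ideal_pow R I k) (carrier M))
       \<subseteq> module_colon R M (ideal_smult M (ideal_pow R I (n + l)) (carrier M))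
                          (ideal_smult M (ideal_pow R I l) (carrier M))"
proof
  fix x
  let ?P = "\<lambda>n. ideal_smult M (ideal_pow R I n) (carrier M)"
  assume x: "x \<in> module_colon R M (?P (n + k)) (?P k)"
  obtain d where l: "l = d + k"
    using \<open>k \<le> l\<close> by (metis add.commute le_Suc_ex)
  have split: "?P (d + e) = ideal_smult M (ideal_pow R I d) (?P e)" for e
    using ideal_smult_prod[OF ideal_pow_ideal[OF I] ideal_pow_ideal[OF I]]
    by (simp add: ideal_pow_add[OF I])
  have Pc: "?P e \<subseteq> carrier M" for e
    using ideal_smult_closed[of "ideal_pow R I e" "carrier M"] ideal.Icarr[OF ideal_pow_ideal[OF I]]
    by blast
  have xR: "x \<in> carrier R" and xk: "\<And>m. m \<in> ?P k \<Longrightarrow> x \<odot>\<^bsub>M\<^esub> m \<in> ?P (n + k)"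
    using x by (auto simp: module_colon_def)
  have dc: "ideal_pow R I d \<subseteq> carrier R"
    using ideal.Icarr[OF ideal_pow_ideal[OF I]] by blast
  have "x \<odot>\<^bsub>M\<^esub> m \<in> ideal_smult M (ideal_pow R I d) (?P (n + k))"
    if "m \<in> ideal_smult M (ideal_pow R I d) (?P k)" for m
    using that
  proof induction
    case (prod a m)
    have "a \<in> carrier R" "m \<in> carrier M"
      using prod dc Pc by blast+
    then have "x \<odot>\<^bsub>M\<^esub> (a \<odot>\<^bsub>M\<^esub> m) = a \<odot>\<^bsub>M\<^esub> (x \<odot>\<^bsub>M\<^esub> m)"
      using xR by (metis smult_assoc1 m_comm)
    then show ?case
      using prod xk by (auto intro: ideal_smult.prod)
  next
    case (sum s t)
    have "s \<in> carrier M" "t \<in> carrier M"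
      using ideal_smult_closed[OF dc Pc] sum by blast+
    then show ?case
      using sum xR by (simp add: smult_r_distr ideal_smult.sum)
  qed
  then have "x \<odot>\<^bsub>M\<^esub> m \<in> ?P (n + l)" if "m \<in> ?P l" for m
    using that split[of k] split[of "n + k"] by (simp add: l add.left_commute)
  then show "x \<in> module_colon R M (?P (n + l)) (?P l)"
    using xR by (simp add: module_colon_def)
qed

lemma (in module) ratliff_rush_pow:
  assumes I: "ideal I R" and n: "n \<ge> 1"
  shows "ratliff_rush R M (ideal_pow R I n) =
    (\<Union>k\<in>{1..}. module_colon R M (ideal_smult M (ideal_pow R I (n + k)) (carrier M))
                                (ideal_smult M (ideal_pow R I k) (carrier M)))"
    (is "_ = (\<Union>k\<in>{1..}. ?C k)")
proof -
  have "ratliff_rush R M (ideal_pow R I n) = (\<Union>k\<in>{1..}. ?C (n * k))"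
    unfolding ratliff_rush_def ideal_pow_pow[OF I] by (simp add: algebra_simps)
  moreover have "?C k \<subseteq> ?C (n * k)" for k
    using module_colon_pow_mono[OF I, of k "n * k" n] n by simp
  moreover have "n * k \<in> {1..}" if "k \<in> {1..}" for k
    using n that by (cases n; cases k) auto
  ultimately show ?thesis by blast
qed

lemma (in module) ratliff_rush_pow_0:
  assumes I: "ideal I R"
  shows "ratliff_rush R M (ideal_pow R I 0) = carrier R"
proof -
  have I0: "ideal_pow R I 0 = carrier R"
    by (simp add: ideals_set_def)
  have "x \<odot>\<^bsub>M\<^esub> m \<in> ideal_smult M (carrier R) (carrier M)"
    if "x \<in> carrier R" "m \<in> ideal_smult M (carrier R) (carrier M)" for x m
    using that ideal_smult_left[of x "carrier R" "carrier M" "carrier R" m] by auto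
  then show ?thesis
    unfolding ratliff_rush_def ideal_pow_pow[OF I] mult_0
    unfolding I0 by (auto simp: module_colon_def)
qed

definition ideal_filtration :: "('a, 'r) ring_scheme \<Rightarrow> (nat \<Rightarrow> 'a set) \<Rightarrow> bool" where
  "ideal_filtration R F \<longleftrightarrow>
     F 0 = carrier R \<and> (\<forall>n. ideal (F n) R) \<and> (\<forall>n. F (Suc n) \<subseteq> F n)"

definition stable_filtration ::
    "('a, 'r) ring_scheme \<Rightarrow> 'a set \<Rightarrow> (nat \<Rightarrow> 'a set) \<Rightarrow> bool" where
  "stable_filtration R I F \<longleftrightarrow>
     ideal_filtration R F \<and>
     (\<forall>n. I \<cdot>\<^bsub>R\<^esub> F n \<subseteq> F (Suc n)) \<and>
     (\<forall>\<^sub>F n in sequentially. I \<cdot>\<^bsub>R\<^esub> F n = F (Suc n))"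

end

theory Submission
  imports Defs "HOL-Library.Multiset_Order" "HOL-Library.Product_Lexorder"
begin

text \<open>
  Write \<open>F\<^sub>n = r(I\<^sup>n, M)\<close>, the union of the ideals \<open>(I\<^sup>n\<^sup>+\<^sup>k M : I\<^sup>k M)\<close>.  That these ideals form a
  decreasing chain with \<open>I F\<^sub>n \<subseteq> F\<^sub>n\<^sub>+\<^sub>1\<close> is formal; the content is that \<open>I F\<^sub>n = F\<^sub>n\<^sub>+\<^sub>1\<close> for large \<open>n\<close>.

  The finiteness behind it is that the Rees module, the direct sum of all \<open>I\<^sup>n M\<close>, is Noetherian over
  the Rees algebra.  In terms of sequences of submodules
  (\<open>adic_submodules_stable\<close>): if \<open>N\<^sub>n \<subseteq> I\<^sup>n M\<close> and \<open>I N\<^sub>n \<subseteq> N\<^sub>n\<^sub>+\<^sub>1\<close> for all \<open>n\<close>, then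
  \<open>N\<^sub>n\<^sub>+\<^sub>1 = I N\<^sub>n\<close> for large \<open>n\<close>.  The proof is the one behind Groebner bases.  For generators
  \<open>a\<^sub>i\<close> of \<open>I\<close> and \<open>g\<^sub>j\<close> of \<open>M\<close>, the module \<open>I\<^sup>n M\<close> is spanned by the terms \<open>a\<^sup>\<mu> g\<^sub>j\<close> of degree \<open>n\<close>.
  Terms are totally ordered, \<open>N\<^sub>n\<close> has an ideal of leading coefficients at every term, and this ideal
  grows when the term is multiplied by some \<open>a\<^sub>i\<close>.  By Dickson's lemma and the ascending chain
  condition, only finitely many terms have an ideal strictly larger than the ideals at all terms with
  one \<open>a\<^sub>i\<close> removed (\<open>finite_minimal_jumps\<close>).  In all higher degrees every leading coefficient of \<open>N\<^sub>n\<^sub>+\<^sub>1\<close> is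
  already one of \<open>I N\<^sub>n\<close>, and a submodule with the same leading coefficients is the whole module.

  The stability result is used three times.

  With \<open>x \<in> I\<close> a nonzerodivisor on \<open>M\<close>, applied to \<open>I\<^sup>n M \<inter> x M\<close> it is the Artin-Rees lemma and
  gives a constant \<open>c\<close> such that \<open>x m \<in> I\<^sup>n\<^sup>+\<^sup>c M\<close> implies \<open>m \<in> I\<^sup>n M\<close>.

  Applied to the elements of \<open>I\<^sup>n M\<close> that \<open>I\<close> multiplies into \<open>I\<^sup>n\<^sup>+\<^sup>2 M\<close>, it shows that in high
  degrees no nonzero element of the associated graded module is killed by \<open>I/I\<^sup>2\<close>.  Together with
  the first application, \<open>I m \<subseteq> I\<^sup>n\<^sup>+\<^sup>1 M\<close> implies \<open>m \<in> I\<^sup>n M\<close> for large \<open>n\<close>, and therefore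
  \<open>F\<^sub>n M \<subseteq> I\<^sup>n M\<close> for large \<open>n\<close> (\<open>colon_adic_smult_eventually\<close>).

  Since \<open>M\<close> is faithful with generators \<open>g\<^sub>1, \<dots>, g\<^sub>s\<close>, the map \<open>b \<mapsto> (b g\<^sub>1, \<dots>, b g\<^sub>s)\<close> embeds \<open>F\<^sub>n\<close>
  into \<open>(I\<^sup>n M)\<^sup>s\<close>.  Applied to one coordinate after the other, the stability result yields
  \<open>I F\<^sub>n = F\<^sub>n\<^sub>+\<^sub>1\<close> (\<open>ideal_filtration_stable_if_faithful\<close>).
\<close>

section \<open>Dickson's lemma and jumps of monotone families of ideals\<close>

lemma simultaneous_mono_subsequence:
  fixes f :: "'k \<Rightarrow> nat \<Rightarrow> nat"
  assumes "finite K"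
  shows "\<exists>g :: nat \<Rightarrow> nat. strict_mono g \<and> (\<forall>k\<in>K. mono (f k \<circ> g))"
  using assms
proof induction
  case empty
  have "strict_mono (id :: nat \<Rightarrow> nat)" by (simp add: strict_mono_def)
  then show ?case by auto
next
  case (insert k K)
  then obtain g :: "nat \<Rightarrow> nat" where g: "strict_mono g" "\<forall>k\<in>K. mono (f k \<circ> g)" by blast
  have "\<exists>h :: nat \<Rightarrow> nat. strict_mono h \<and> mono (f k \<circ> g \<circ> h)"
  proof -
    obtain h :: "nat \<Rightarrow> nat" where h: "strict_mono h" "monoseq (f k \<circ> g \<circ> h)"
      using seq_monosub[of "f k \<circ> g"] by (auto simp: comp_def)
    show ?thesis
    proof (cases "mono (f k \<circ> g \<circ> h)")
      case False
      then have dec: "antimono (f k \<circ> g \<circ> h)"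
        using h(2) by (auto simp: monoseq_iff)
      \<comment> \<open>A weakly decreasing sequence of natural numbers is constant from its minimum onwards.\<close>
      obtain n where n: "\<forall>m. (f k \<circ> g \<circ> h) n \<le> (f k \<circ> g \<circ> h) m"
        using ex_has_least_nat[of "\<lambda>_. True" 0 "f k \<circ> g \<circ> h"] by auto
      have "(f k \<circ> g \<circ> h) (n + m) = (f k \<circ> g \<circ> h) n" for m
        using n antimonoD[OF dec, of n "n + m"] by (intro antisym) auto
      then have "mono (f k \<circ> g \<circ> (h \<circ> (+) n))"
        by (simp add: mono_def)
      moreover have "strict_mono (h \<circ> (+) n)"
        using h(1) by (simp add: strict_mono_def)
      ultimately show ?thesis by blast
    qed (use h in blast)
  qed
  then obtain h :: "nat \<Rightarrow> nat" where h: "strict_mono h" "mono (f k \<circ> g \<circ> h)" by blast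
  have "strict_mono (g \<circ> h)"
    using g(1) h(1) by (simp add: strict_mono_def)
  moreover have "mono (f l \<circ> (g \<circ> h))" if "l \<in> K" for l
    using g(2) that strict_mono_mono[OF h(1)] by (auto simp: mono_def)
  ultimately show ?case
    using h(2) by (metis comp_assoc insert_iff)
qed

text \<open>Multisets over \<open>A\<close> are exponent vectors of monomials in the variables \<open>A\<close>, and \<open>\<subset>#\<close> is proper
  divisibility.  A sequence of distinct members of \<open>B\<close> has a subsequence along which every exponent
  is weakly increasing.\<close>
lemma dickson_multiset:
  assumes "finite A" "infinite B" "\<And>\<mu>. \<mu> \<in> B \<Longrightarrow> set_mset \<mu> \<subseteq> A"
  shows "\<exists>f :: nat \<Rightarrow> 'x multiset. range f \<subseteq> B \<and> (\<forall>i. f i \<subset># f (Suc i))"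
proof -
  obtain f :: "nat \<Rightarrow> 'x multiset" where f: "inj f" "range f \<subseteq> B"
    using infinite_countable_subset[OF assms(2)] by blast
  obtain g :: "nat \<Rightarrow> nat" where g: "strict_mono g" "\<forall>x\<in>A. mono ((\<lambda>n. count (f n) x) \<circ> g)"
    using simultaneous_mono_subsequence[OF assms(1), of "\<lambda>x n. count (f n) x"] by blast
  have "f (g i) \<subset># f (g (Suc i))" for i :: nat
  proof -
    have "count (f (g i)) x \<le> count (f (g (Suc i))) x" for x
    proof (cases "x \<in> A")
      case True
      then show ?thesis using g(2) by (auto simp: mono_def)
    next
      case False
      then have "x \<notin># f (g i)" using assms(3)[of "f (g i)"] f(2) by blast
      then show ?thesis by (simp add: not_in_iff)
    qed
    moreover have "f (g i) \<noteq> f (g (Suc i))"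
      using f(1) g(1) by (metis inj_eq n_not_Suc_n strict_mono_eq)
    ultimately show ?thesis
      by (simp add: subset_mset.less_le mset_subset_eqI)
  qed
  then show ?thesis using f(2) by (intro exI[of _ "f \<circ> g"]) auto
qed

lemma (in noetherian_ring) no_strict_ideal_chain:
  assumes "\<And>n :: nat. ideal (J n) R"
  shows "\<exists>n. \<not> J n \<subset> J (Suc n)"
proof (rule ccontr)
  assume "\<nexists>n. \<not> J n \<subset> J (Suc n)"
  then have strict: "J n \<subset> J (Suc n)" for n by blast
  then have mono: "J m \<subseteq> J n" if "m \<le> n" for m n
    using lift_Suc_mono_le[of J m n] that by blast
  have "subset.chain {I. ideal I R} (range J)"
    unfolding subset.chain_def using assms
    by (auto simp: psubset_eq) (metis linorder_linear mono subsetD)+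
  then have "\<Union>(range J) \<in> range J"
    by (intro ideal_chain_is_trivial) auto
  then obtain n where "\<Union>(range J) = J n" by blast
  then show False using strict[of n] by blast
qed

text \<open>The set collects the monomials at which \<open>C\<close> is strictly larger than at every monomial obtained by
  removing one variable.  An infinite set of them would contain, by Dickson's lemma, a strictly
  divisible chain of monomials, and along it \<open>C\<close> would be a strictly ascending chain of ideals: the
  last variable added between two neighbours already enlarges \<open>C\<close>.\<close>
lemma (in noetherian_ring) finite_minimal_jumps:
  assumes A: "finite A"
    and C: "\<And>\<mu>. set_mset \<mu> \<subseteq> A \<Longrightarrow> ideal (C \<mu>) R"
    and mono: "\<And>\<mu> i. \<lbrakk>set_mset \<mu> \<subseteq> A; i \<in> A\<rbrakk> \<Longrightarrow> C \<mu> \<subseteq> C (add_mset i \<mu>)"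
  shows "finite {\<mu>. set_mset \<mu> \<subseteq> A \<and> (\<forall>i\<in>#\<mu>. C (\<mu> - {#i#}) \<noteq> C \<mu>)}" (is "finite ?B")
proof (rule ccontr)
  assume "infinite ?B"
  then obtain f where f: "range f \<subseteq> ?B" "\<And>i. f i \<subset># f (Suc i)"
    using dickson_multiset[OF A, of ?B] by blast
  have add: "C \<mu> \<subseteq> C (\<nu> + \<mu>)" if "set_mset \<mu> \<subseteq> A" "set_mset \<nu> \<subseteq> A" for \<mu> \<nu>
    using that(2)
  proof (induction \<nu>)
    case (add i \<nu>)
    then show ?case using mono[of "\<nu> + \<mu>" i] that(1) by auto
  qed simp
  have "C (f k) \<subset> C (f (Suc k))" for k
  proof -
    have fA: "set_mset (f l) \<subseteq> A" "\<forall>i\<in>#f l. C (f l - {#i#}) \<noteq> C (f l)" for l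
      using f(1) by blast+
    obtain \<nu> where \<nu>: "f (Suc k) = f k + \<nu>" "\<nu> \<noteq> {#}"
      using f(2)[of k] by (metis add_0_right subset_mset.le_iff_add subset_mset.less_le)
    obtain i \<nu>' where i: "\<nu> = add_mset i \<nu>'"
      using \<nu>(2) by (metis multiset_cases)
    have iA: "set_mset \<nu>' \<subseteq> A" "i \<in> A"
      using fA(1)[of "Suc k"] \<nu> i by auto
    have "C (f k) \<subseteq> C (\<nu>' + f k)"
      using add fA(1) iA by blast
    moreover have "C (\<nu>' + f k) \<subseteq> C (f (Suc k))"
      using mono[of "\<nu>' + f k" i] fA(1)[of k] iA \<nu>(1) i by (simp add: add.commute)
    moreover have "C (\<nu>' + f k) \<noteq> C (f (Suc k))"
      using fA(2)[of "Suc k"] \<nu>(1) i by (simp add: add.commute)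
    ultimately show ?thesis by blast
  qed
  moreover have "ideal (C (f k)) R" for k
    using C f(1) by blast
  ultimately show False
    using no_strict_ideal_chain[of "\<lambda>k. C (f k)"] by blast
qed

section \<open>Spans of families and their leading terms\<close>

text \<open>Spans of indexed families, with the indices as a separate argument, so that the span of the terms
  below a given term is obtained by restricting the index set.\<close>
inductive_set module_span ::
    "('a, 'r) ring_scheme \<Rightarrow> ('a, 'b, 'm) module_scheme \<Rightarrow> ('i \<Rightarrow> 'b) \<Rightarrow> 'i set \<Rightarrow> 'b set"
  for R and M and e and U where
    zero: "\<zero>\<^bsub>M\<^esub> \<in> module_span R M e U"
  | add: "\<lbrakk>c \<in> carrier R; u \<in> U; y \<in> module_span R M e U\<rbrakk>
      \<Longrightarrow> c \<odot>\<^bsub>M\<^esub> e u \<oplus>\<^bsub>M\<^esub> y \<in> module_span R M e U"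

context module
begin

lemma smult_left_commute:
  "\<lbrakk>a \<in> carrier R; b \<in> carrier R; x \<in> carrier M\<rbrakk> \<Longrightarrow> a \<odot>\<^bsub>M\<^esub> (b \<odot>\<^bsub>M\<^esub> x) = b \<odot>\<^bsub>M\<^esub> (a \<odot>\<^bsub>M\<^esub> x)"
  by (metis smult_assoc1 m_comm)

lemma module_span_carrier:
  assumes "e ` U \<subseteq> carrier M" "y \<in> module_span R M e U"
  shows "y \<in> carrier M"
  using assms(2,1) by induction auto

lemma module_span_mono:
  assumes "U \<subseteq> V"
  shows "module_span R M e U \<subseteq> module_span R M e V"
proof
  fix y assume "y \<in> module_span R M e U"
  then show "y \<in> module_span R M e V"
    using assms by induction (auto intro: module_span.intros)
qed

lemma module_span_gen:
  assumes "e u \<in> carrier M" "u \<in> U" "c \<in> carrier R"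
  shows "c \<odot>\<^bsub>M\<^esub> e u \<in> module_span R M e U"
  using module_span.add[OF assms(3,2) module_span.zero, of M e] assms by simp

lemma module_span_add:
  assumes "e ` U \<subseteq> carrier M" "y \<in> module_span R M e U" "z \<in> module_span R M e U"
  shows "y \<oplus>\<^bsub>M\<^esub> z \<in> module_span R M e U"
  using assms(2)
proof induction
  case zero
  then show ?case using module_span_carrier[OF assms(1,3)] assms(3) by simp
next
  case (add c u y)
  have "e u \<in> carrier M" "y \<in> carrier M" "z \<in> carrier M"
    using add assms module_span_carrier[OF assms(1)] by auto
  then show ?case
    using add module_span.add[OF add(1,2,4)] by (simp add: M.a_assoc)
qed

text \<open>The form in which multiplication by a variable carries spans of terms of degree \<open>n\<close> to spans of
  terms of degree \<open>n + 1\<close>.\<close>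
lemma module_span_smult:
  assumes "e ` U \<subseteq> carrier M" "e' ` V \<subseteq> carrier M" "a \<in> carrier R"
    and "\<And>u. u \<in> U \<Longrightarrow> \<exists>v\<in>V. a \<odot>\<^bsub>M\<^esub> e u = e' v"
    and "y \<in> module_span R M e U"
  shows "a \<odot>\<^bsub>M\<^esub> y \<in> module_span R M e' V"
  using assms(5)
proof induction
  case zero
  then show ?case using assms(3) by (simp add: module_span.zero)
next
  case (add c u y)
  obtain v where v: "v \<in> V" "a \<odot>\<^bsub>M\<^esub> e u = e' v" using add assms(4) by blast
  have M: "e u \<in> carrier M" "y \<in> carrier M"
    using add assms module_span_carrier[OF assms(1)] by auto
  then have "a \<odot>\<^bsub>M\<^esub> (c \<odot>\<^bsub>M\<^esub> e u \<oplus>\<^bsub>M\<^esub> y) = c \<odot>\<^bsub>M\<^esub> (a \<odot>\<^bsub>M\<^esub> e u) \<oplus>\<^bsub>M\<^esub> a \<odot>\<^bsub>M\<^esub> y"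
    using add assms(3) by (simp add: smult_r_distr smult_left_commute)
  then show ?case using module_span.add[OF add(1) v(1) add(4)] v(2) by simp
qed

lemma module_span_scale:
  assumes "e ` U \<subseteq> carrier M" "a \<in> carrier R" "y \<in> module_span R M e U"
  shows "a \<odot>\<^bsub>M\<^esub> y \<in> module_span R M e U"
  using assms(3)
proof induction
  case zero
  then show ?case using assms(2) by (simp add: module_span.zero)
next
  case (add c u y)
  have M: "e u \<in> carrier M" "y \<in> carrier M"
    using add assms module_span_carrier[OF assms(1)] by auto
  then have "a \<odot>\<^bsub>M\<^esub> (c \<odot>\<^bsub>M\<^esub> e u \<oplus>\<^bsub>M\<^esub> y) = (a \<otimes> c) \<odot>\<^bsub>M\<^esub> e u \<oplus>\<^bsub>M\<^esub> a \<odot>\<^bsub>M\<^esub> y"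
    using add assms(2) by (simp add: smult_r_distr smult_assoc1)
  then show ?case using module_span.add[of "a \<otimes> c" R u U] add assms(2) by simp
qed

text \<open>Collecting coefficients of equal indices lets the largest index be split off.  The coefficient \<open>c\<close>
  may still vanish, and the representation need not be unique, because the family may have
  relations.\<close>
lemma module_span_leading_term:
  fixes U :: "'i :: linorder set"
  assumes e: "e ` U \<subseteq> carrier M" and y: "y \<in> module_span R M e U"
  shows "y = \<zero>\<^bsub>M\<^esub> \<or> (\<exists>u\<in>U. \<exists>c\<in>carrier R. \<exists>z\<in>module_span R M e {v\<in>U. v < u}.
    y = c \<odot>\<^bsub>M\<^esub> e u \<oplus>\<^bsub>M\<^esub> z)"
  using y
proof induction
  case (add c u y)
  have eu: "e u \<in> carrier M" using add e by blast
  have yU: "y \<in> carrier M" by (rule module_span_carrier[OF e add(3)])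
  from add(4) consider "y = \<zero>\<^bsub>M\<^esub>"
    | v d z where "v \<in> U" "d \<in> carrier R" "z \<in> module_span R M e {w\<in>U. w < v}"
        "y = d \<odot>\<^bsub>M\<^esub> e v \<oplus>\<^bsub>M\<^esub> z" by blast
  then show ?case
  proof cases
    case 1
    then show ?thesis using add module_span.zero by blast
  next
    case (2 v d z)
    have ev: "e v \<in> carrier M" using 2 e by blast
    have zM: "z \<in> carrier M" using module_span_carrier[OF _ 2(3)] e by blast
    consider "u < v" | "u = v" | "v < u" by force
    then show ?thesis
    proof cases
      case 1
      have "c \<odot>\<^bsub>M\<^esub> e u \<oplus>\<^bsub>M\<^esub> z \<in> module_span R M e {w\<in>U. w < v}"
        using add 1 2 by (intro module_span.add) auto
      moreover have "c \<odot>\<^bsub>M\<^esub> e u \<oplus>\<^bsub>M\<^esub> y = d \<odot>\<^bsub>M\<^esub> e v \<oplus>\<^bsub>M\<^esub> (c \<odot>\<^bsub>M\<^esub> e u \<oplus>\<^bsub>M\<^esub> z)"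
        using 2 eu ev zM add by (simp add: M.a_lcomm)
      ultimately show ?thesis using 2 by blast
    next
      case u: 2
      have "c \<odot>\<^bsub>M\<^esub> e u \<oplus>\<^bsub>M\<^esub> y = (c \<oplus> d) \<odot>\<^bsub>M\<^esub> e v \<oplus>\<^bsub>M\<^esub> z"
        using 2 u eu ev zM add by (simp add: M.a_assoc smult_l_distr)
      moreover have "c \<oplus> d \<in> carrier R" using add 2 by simp
      ultimately show ?thesis using 2 by blast
    next
      case 3
      have "z \<in> module_span R M e {w\<in>U. w < u}"
        using module_span_mono[of "{w\<in>U. w < v}" "{w\<in>U. w < u}" e] 2(3) 3 by fastforce
      then have "y \<in> module_span R M e {w\<in>U. w < u}"
        unfolding 2(4) using 2 3 by (intro module_span.add) auto
      then show ?thesis using add by blast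
    qed
  qed
qed simp

end

section \<open>Leading coefficients\<close>

text \<open>The coefficients at \<open>t\<close> of those elements of \<open>N\<close> that have some representation whose terms are all
  at most \<open>t\<close>.  Referring to representations instead of polynomials makes relations among the
  \<open>e u\<close> harmless.\<close>
definition lead_coeffs ::
    "('a, 'r) ring_scheme \<Rightarrow> ('a, 'b, 'm) module_scheme \<Rightarrow> ('i :: linorder \<Rightarrow> 'b) \<Rightarrow> 'i set
      \<Rightarrow> 'b set \<Rightarrow> 'i \<Rightarrow> 'a set" where
  "lead_coeffs R M e U N t =
    {c \<in> carrier R. \<exists>y\<in>module_span R M e {u\<in>U. u < t}. c \<odot>\<^bsub>M\<^esub> e t \<oplus>\<^bsub>M\<^esub> y \<in> N}"

text \<open>The product of the \<open>a i\<close> over the multiset \<open>\<mu>\<close>.  Sorting turns it into a fold over a list, whose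
  definition does not rely on commutativity outside the carrier.\<close>
definition monomial_value :: "('a, 'r) ring_scheme \<Rightarrow> (nat \<Rightarrow> 'a) \<Rightarrow> nat multiset \<Rightarrow> 'a" where
  "monomial_value R a \<mu> = foldr (\<lambda>i c. a i \<otimes>\<^bsub>R\<^esub> c) (sorted_list_of_multiset \<mu>) \<one>\<^bsub>R\<^esub>"

text \<open>A term is a pair of the index of a module generator and a monomial.  Pairs are compared
  lexicographically and monomials by the multiset order; this is a well-order that is preserved by
  multiplication with a variable.\<close>
definition term_value ::
    "('a, 'r) ring_scheme \<Rightarrow> ('a, 'b, 'm) module_scheme \<Rightarrow> (nat \<Rightarrow> 'a) \<Rightarrow> (nat \<Rightarrow> 'b)
      \<Rightarrow> nat \<times> nat multiset \<Rightarrow> 'b" where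
  "term_value R M a g t = monomial_value R a (snd t) \<odot>\<^bsub>M\<^esub> g (fst t)"

definition terms :: "nat \<Rightarrow> nat \<Rightarrow> nat \<Rightarrow> (nat \<times> nat multiset) set" where
  "terms s r n = {..<s} \<times> {\<mu>. set_mset \<mu> \<subseteq> {..<r} \<and> size \<mu> = n}"

context module
begin

lemma submodule_zero: "submodule N R M \<Longrightarrow> \<zero>\<^bsub>M\<^esub> \<in> N"
  using submoduleE(1,2,4)[of N] by (metis R.zero_closed all_not_in_conv smult_l_null subsetD)

lemma lead_coeffs_ideal:
  assumes N: "submodule N R M" and e: "e ` U \<subseteq> carrier M" "e t \<in> carrier M"
  shows "ideal (lead_coeffs R M e U N t) R"
proof -
  let ?L = "lead_coeffs R M e U N t" and ?S = "module_span R M e {u\<in>U. u < t}"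
  have eU: "e ` {u\<in>U. u < t} \<subseteq> carrier M" using e by blast
  note S = module_span_carrier[OF eU]
  have scale: "x \<otimes> c \<in> ?L" if x: "x \<in> carrier R" and c: "c \<in> ?L" for x c
  proof -
    obtain y where y: "c \<in> carrier R" "y \<in> ?S" "c \<odot>\<^bsub>M\<^esub> e t \<oplus>\<^bsub>M\<^esub> y \<in> N"
      using c by (auto simp: lead_coeffs_def)
    have "x \<odot>\<^bsub>M\<^esub> (c \<odot>\<^bsub>M\<^esub> e t \<oplus>\<^bsub>M\<^esub> y) = (x \<otimes> c) \<odot>\<^bsub>M\<^esub> e t \<oplus>\<^bsub>M\<^esub> x \<odot>\<^bsub>M\<^esub> y"
      using x y S e by (simp add: smult_r_distr smult_assoc1)
    moreover have "x \<odot>\<^bsub>M\<^esub> (c \<odot>\<^bsub>M\<^esub> e t \<oplus>\<^bsub>M\<^esub> y) \<in> N"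
      using submoduleE(4)[OF N] x y by blast
    ultimately show ?thesis
      using x y module_span_scale[OF eU x] by (auto simp: lead_coeffs_def)
  qed
  have add: "c \<oplus> d \<in> ?L" if c: "c \<in> ?L" and d: "d \<in> ?L" for c d
  proof -
    obtain y where y: "c \<in> carrier R" "y \<in> ?S" "c \<odot>\<^bsub>M\<^esub> e t \<oplus>\<^bsub>M\<^esub> y \<in> N"
      using c by (auto simp: lead_coeffs_def)
    obtain z where z: "d \<in> carrier R" "z \<in> ?S" "d \<odot>\<^bsub>M\<^esub> e t \<oplus>\<^bsub>M\<^esub> z \<in> N"
      using d by (auto simp: lead_coeffs_def)
    have "(c \<odot>\<^bsub>M\<^esub> e t \<oplus>\<^bsub>M\<^esub> y) \<oplus>\<^bsub>M\<^esub> (d \<odot>\<^bsub>M\<^esub> e t \<oplus>\<^bsub>M\<^esub> z) = (c \<oplus> d) \<odot>\<^bsub>M\<^esub> e t \<oplus>\<^bsub>M\<^esub> (y \<oplus>\<^bsub>M\<^esub> z)"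
      using y z S e by (simp add: smult_l_distr M.a_ac)
    then show ?thesis
      using y z submoduleE(5)[OF N y(3) z(3)] module_span_add[OF eU y(2) z(2)]
      by (auto simp: lead_coeffs_def)
  qed
  have LR: "?L \<subseteq> carrier R" by (auto simp: lead_coeffs_def)
  have zero: "\<zero> \<in> ?L"
    using e submodule_zero[OF N] by (auto simp: lead_coeffs_def intro!: bexI[OF _ module_span.zero])
  show ?thesis
  proof (rule idealI)
    show "subgroup ?L (add_monoid R)"
    proof (rule R.add.subgroupI)
      fix c assume c: "c \<in> ?L"
      then have "\<ominus> c = \<ominus> \<one> \<otimes> c"
        using LR by (metis R.l_minus R.l_one R.one_closed subsetD)
      then show "\<ominus> c \<in> ?L" using scale[OF _ c] by simp
    qed (use LR zero add in auto)
    show "c \<otimes> x \<in> ?L" if "c \<in> ?L" "x \<in> carrier R" for c x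
      using scale[of x c] that LR by (metis m_comm subsetD)
  qed (use scale R.ring_axioms in auto)
qed

text \<open>Division with remainder: subtracting from \<open>y \<in> N\<close> an element of \<open>H\<close> with the same leading
  coefficient leaves an element of \<open>N\<close> with a smaller leading term, so well-founded induction on the
  leading term applies.\<close>
lemma submodule_eq_if_lead_coeffs_eq:
  fixes U :: "'i :: wellorder set"
  assumes N: "submodule N R M" and H: "submodule H R M" and HN: "H \<subseteq> N"
    and e: "e ` U \<subseteq> carrier M" and NU: "N \<subseteq> module_span R M e U"
    and lead: "\<And>t. t \<in> U \<Longrightarrow> lead_coeffs R M e U N t \<subseteq> lead_coeffs R M e U H t"
  shows "N = H"
proof
  have *: "y \<in> H" if "t \<in> U" "y \<in> N" "c \<in> carrier R" "z \<in> module_span R M e {u\<in>U. u < t}"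
      "y = c \<odot>\<^bsub>M\<^esub> e t \<oplus>\<^bsub>M\<^esub> z" for t y c z
    using that
  proof (induction t arbitrary: y c z rule: less_induct)
    case (less t)
    have et: "e t \<in> carrier M" "e ` {u\<in>U. u < t} \<subseteq> carrier M" using e less by auto
    note S = module_span_carrier[OF et(2)]
    have "c \<in> lead_coeffs R M e U N t"
      using less by (auto simp: lead_coeffs_def)
    then obtain z' where z': "z' \<in> module_span R M e {u\<in>U. u < t}" "c \<odot>\<^bsub>M\<^esub> e t \<oplus>\<^bsub>M\<^esub> z' \<in> H"
      using lead[OF less(2)] by (auto simp: lead_coeffs_def)
    \<comment> \<open>\<open>h\<close> cancels the leading term of \<open>y\<close>, and \<open>x\<close> is the remainder \<open>y - h\<close>.\<close>
    define h where "h = c \<odot>\<^bsub>M\<^esub> e t \<oplus>\<^bsub>M\<^esub> z'"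
    define x where "x = z \<oplus>\<^bsub>M\<^esub> (\<ominus> \<one>) \<odot>\<^bsub>M\<^esub> z'"
    have car: "z \<in> carrier M" "z' \<in> carrier M" "h \<in> carrier M" "x \<in> carrier M"
      using S less z' et unfolding h_def x_def by auto
    have neg: "(\<ominus> \<one>) \<odot>\<^bsub>M\<^esub> w = \<ominus>\<^bsub>M\<^esub> w" if "w \<in> carrier M" for w
      using that by (simp add: smult_l_minus)
    have "h \<oplus>\<^bsub>M\<^esub> x = (c \<odot>\<^bsub>M\<^esub> e t \<oplus>\<^bsub>M\<^esub> z) \<oplus>\<^bsub>M\<^esub> (z' \<oplus>\<^bsub>M\<^esub> \<ominus>\<^bsub>M\<^esub> z')"
      unfolding h_def x_def using car less et by (simp add: neg M.a_ac)
    then have y: "y = h \<oplus>\<^bsub>M\<^esub> x"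
      using car less et by (simp add: M.r_neg)
    have "x = y \<oplus>\<^bsub>M\<^esub> \<ominus>\<^bsub>M\<^esub> h"
      unfolding y using car by (simp add: M.a_assoc M.a_lcomm[of h x] M.r_neg)
    then have xN: "x \<in> N"
      using less z' HN submoduleE(3,5)[OF N] unfolding h_def by blast
    have xS: "x \<in> module_span R M e {u\<in>U. u < t}"
      unfolding x_def using less z' module_span_add[OF et(2)] module_span_scale[OF et(2)] by simp
    have "x \<in> H"
      using module_span_leading_term[OF et(2) xS]
    proof
      assume "\<exists>u\<in>{u \<in> U. u < t}. \<exists>c\<in>carrier R. \<exists>z\<in>module_span R M e {v \<in> {u \<in> U. u < t}. v < u}.
        x = c \<odot>\<^bsub>M\<^esub> e u \<oplus>\<^bsub>M\<^esub> z"
      then obtain u c' z'' where u: "u \<in> U" "u < t" "c' \<in> carrier R"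
        "z'' \<in> module_span R M e {v \<in> {u \<in> U. u < t}. v < u}" "x = c' \<odot>\<^bsub>M\<^esub> e u \<oplus>\<^bsub>M\<^esub> z''"
        by blast
      have "z'' \<in> module_span R M e {v \<in> U. v < u}"
        using u(4) module_span_mono[of "{v \<in> {u \<in> U. u < t}. v < u}" "{v \<in> U. v < u}"] by blast
      then show ?thesis using less.IH[OF u(2,1) xN u(3)] u(5) by blast
    qed (use submodule_zero[OF H] in simp)
    then show ?case using y z'(2) submoduleE(5)[OF H] unfolding h_def by blast
  qed
  show "N \<subseteq> H"
  proof
    fix y assume y: "y \<in> N"
    then show "y \<in> H"
      using module_span_leading_term[OF e, of y] NU * submodule_zero[OF H] by blast
  qed
qed (fact HN)

section \<open>Stability of graded families of submodules\<close>

lemma monomial_value_closed: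
  assumes "\<And>i. i < r \<Longrightarrow> a i \<in> carrier R" "set_mset \<mu> \<subseteq> {..<r}"
  shows "monomial_value R a \<mu> \<in> carrier R"
proof -
  have "foldr (\<lambda>i c. a i \<otimes> c) xs \<one> \<in> carrier R" if "set xs \<subseteq> {..<r}" for xs
    using that by (induction xs) (auto simp: assms(1))
  then show ?thesis using assms(2) by (simp add: monomial_value_def)
qed

lemma monomial_value_add_mset:
  assumes a: "\<And>i. i < r \<Longrightarrow> a i \<in> carrier R" and "set_mset \<mu> \<subseteq> {..<r}" "i < r"
  shows "monomial_value R a (add_mset i \<mu>) = a i \<otimes> monomial_value R a \<mu>"
proof -
  have "foldr (\<lambda>i c. a i \<otimes> c) xs \<one> \<in> carrier R" if "set xs \<subseteq> {..<r}" for xs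
    using that by (induction xs) (auto simp: a)
  then have "foldr (\<lambda>i c. a i \<otimes> c) (insort i xs) \<one> = a i \<otimes> foldr (\<lambda>i c. a i \<otimes> c) xs \<one>"
    if "set xs \<subseteq> {..<r}" for xs
    using that assms(3) by (induction xs) (auto simp: a m_lcomm)
  then show ?thesis using assms(2) by (simp add: monomial_value_def)
qed

context
  fixes r s :: nat and a g and E
  defines "E \<equiv> term_value R M a g"
  assumes a: "\<And>i. i < r \<Longrightarrow> a i \<in> carrier R" and g: "\<And>j. j < s \<Longrightarrow> g j \<in> carrier M"
begin

lemma term_value_carrier: "E ` terms s r n \<subseteq> carrier M"
  using monomial_value_closed[OF a] g by (auto simp: E_def term_value_def terms_def)

lemma term_value_shift:
  assumes "(j, \<mu>) \<in> terms s r n" "i < r"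
  shows "a i \<odot>\<^bsub>M\<^esub> E (j, \<mu>) = E (j, add_mset i \<mu>)"
  using assms monomial_value_closed[where a = a and r = r and \<mu> = \<mu>] monomial_value_add_mset[where a = a and r = r and \<mu> = \<mu> and i = i] a g
  by (auto simp: E_def term_value_def terms_def smult_assoc1)

lemma terms_shift: "(j, \<mu>) \<in> terms s r n \<Longrightarrow> i < r \<Longrightarrow> (j, add_mset i \<mu>) \<in> terms s r (Suc n)"
  by (simp add: terms_def)

text \<open>Multiplying a witness by \<open>a i\<close> multiplies its terms by the variable \<open>i\<close>, which preserves their order.
  With \<open>H = N\<^sub>n\<^sub>+\<^sub>1\<close> this says that leading coefficients grow along divisibility; with a smaller \<open>H\<close>
  it transports them from \<open>N\<^sub>n\<close> into \<open>H\<close>.\<close>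
lemma lead_coeffs_shift:
  assumes c: "c \<in> lead_coeffs R M E (terms s r n) N (j, \<mu>)" and t: "(j, \<mu>) \<in> terms s r n"
    and i: "i < r" and H: "\<And>x. x \<in> N \<Longrightarrow> a i \<odot>\<^bsub>M\<^esub> x \<in> H"
  shows "c \<in> lead_coeffs R M E (terms s r (Suc n)) H (j, add_mset i \<mu>)"
proof -
  let ?U = "{u\<in>terms s r n. u < (j, \<mu>)}" and ?V = "{u\<in>terms s r (Suc n). u < (j, add_mset i \<mu>)}"
  have U: "E ` ?U \<subseteq> carrier M" and V: "E ` ?V \<subseteq> carrier M"
    using term_value_carrier by blast+
  obtain y where y: "c \<in> carrier R" "y \<in> module_span R M E ?U" "c \<odot>\<^bsub>M\<^esub> E (j, \<mu>) \<oplus>\<^bsub>M\<^esub> y \<in> N"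
    using c by (auto simp: lead_coeffs_def)
  have "\<exists>v\<in>?V. a i \<odot>\<^bsub>M\<^esub> E u = E v" if "u \<in> ?U" for u
  proof (cases u)
    case (Pair k \<nu>)
    have "(k, add_mset i \<nu>) \<in> ?V"
      using that i terms_shift unfolding Pair by auto
    then show ?thesis
      using that term_value_shift[where j = k and \<mu> = \<nu> and n = n] i unfolding Pair by blast
  qed
  then have ay: "a i \<odot>\<^bsub>M\<^esub> y \<in> module_span R M E ?V"
    by (rule module_span_smult[OF U V a[OF i] _ y(2)])
  have Et: "E (j, \<mu>) \<in> carrier M" "y \<in> carrier M"
    using t term_value_carrier module_span_carrier[OF U y(2)] by auto
  have "a i \<odot>\<^bsub>M\<^esub> (c \<odot>\<^bsub>M\<^esub> E (j, \<mu>) \<oplus>\<^bsub>M\<^esub> y) = c \<odot>\<^bsub>M\<^esub> (a i \<odot>\<^bsub>M\<^esub> E (j, \<mu>)) \<oplus>\<^bsub>M\<^esub> a i \<odot>\<^bsub>M\<^esub> y"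
    using y Et a[OF i] by (simp add: smult_r_distr smult_left_commute)
  also have "\<dots> = c \<odot>\<^bsub>M\<^esub> E (j, add_mset i \<mu>) \<oplus>\<^bsub>M\<^esub> a i \<odot>\<^bsub>M\<^esub> y"
    using term_value_shift[OF t i] by simp
  finally have "c \<odot>\<^bsub>M\<^esub> E (j, add_mset i \<mu>) \<oplus>\<^bsub>M\<^esub> a i \<odot>\<^bsub>M\<^esub> y \<in> H"
    using H[OF y(3)] by simp
  then show ?thesis using y(1) ay by (auto simp: lead_coeffs_def)
qed

text \<open>Beyond the degrees of the finitely many minimal jumps, each leading coefficient ideal of \<open>N\<^sub>n\<^sub>+\<^sub>1\<close>
  agrees with the one of \<open>N\<^sub>n\<close> at the term with a suitable variable removed.  Multiplying back by that
  variable produces the coefficient inside \<open>H\<close>.\<close>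
lemma graded_submodules_stable:
  assumes noeth: "noetherian_ring R"
    and N: "\<And>n. submodule (N n) R M" "\<And>n. N n \<subseteq> module_span R M E (terms s r n)"
    and shift: "\<And>n i x. \<lbrakk>i < r; x \<in> N n\<rbrakk> \<Longrightarrow> a i \<odot>\<^bsub>M\<^esub> x \<in> N (Suc n)"
  obtains d where "\<And>n H. \<lbrakk>d \<le> n; submodule H R M; H \<subseteq> N (Suc n);
    \<And>i x. \<lbrakk>i < r; x \<in> N n\<rbrakk> \<Longrightarrow> a i \<odot>\<^bsub>M\<^esub> x \<in> H\<rbrakk> \<Longrightarrow> N (Suc n) = H"
proof -
  define C where "C j \<mu> = lead_coeffs R M E (terms s r (size \<mu>)) (N (size \<mu>)) (j, \<mu>)" for j \<mu>
  define B where "B j = {\<mu>. set_mset \<mu> \<subseteq> {..<r} \<and> (\<forall>i\<in>#\<mu>. C j (\<mu> - {#i#}) \<noteq> C j \<mu>)}" for j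
  have "finite (B j)" if j: "j < s" for j
    unfolding B_def
  proof (rule noetherian_ring.finite_minimal_jumps[OF noeth])
    fix \<mu> :: "nat multiset" assume \<mu>: "set_mset \<mu> \<subseteq> {..<r}"
    then have t: "(j, \<mu>) \<in> terms s r (size \<mu>)" using j by (simp add: terms_def)
    then show "ideal (C j \<mu>) R"
      unfolding C_def using N term_value_carrier by (intro lead_coeffs_ideal) blast+
    show "C j \<mu> \<subseteq> C j (add_mset i \<mu>)" if "i \<in> {..<r}" for i
      using lead_coeffs_shift[OF _ t, of _ "N (size \<mu>)" i "N (Suc (size \<mu>))"] shift that
      by (auto simp: C_def)
  qed simp
  then have "finite (size ` (\<Union>j<s. B j))" by simp
  then obtain d where d: "\<And>j \<mu>. j < s \<Longrightarrow> \<mu> \<in> B j \<Longrightarrow> size \<mu> \<le> d"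
    using finite_nat_set_iff_bounded_le by auto
  show ?thesis
  proof (rule that[of d])
    fix n H
    assume n: "d \<le> n" and H: "submodule H R M" "H \<subseteq> N (Suc n)"
      "\<And>i x. \<lbrakk>i < r; x \<in> N n\<rbrakk> \<Longrightarrow> a i \<odot>\<^bsub>M\<^esub> x \<in> H"
    show "N (Suc n) = H"
    proof (rule submodule_eq_if_lead_coeffs_eq[OF N(1) H(1,2) term_value_carrier N(2)])
      fix t assume "t \<in> terms s r (Suc n)"
      then obtain j \<mu> where t: "t = (j, \<mu>)" "j < s" "set_mset \<mu> \<subseteq> {..<r}" "size \<mu> = Suc n"
        by (auto simp: terms_def)
      then have "\<mu> \<notin> B j" using d n by fastforce
      then obtain i \<nu> where i: "\<mu> = add_mset i \<nu>" "C j \<nu> = C j \<mu>"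
        using t(3) unfolding B_def by (auto dest!: multi_member_split)
      have \<nu>: "size \<nu> = n" "(j, \<nu>) \<in> terms s r n" "i < r"
        using t i by (auto simp: terms_def)
      show "lead_coeffs R M E (terms s r (Suc n)) (N (Suc n)) t
          \<subseteq> lead_coeffs R M E (terms s r (Suc n)) H t"
      proof
        fix c assume "c \<in> lead_coeffs R M E (terms s r (Suc n)) (N (Suc n)) t"
        then have "c \<in> C j \<mu>" using t by (simp add: C_def)
        then have "c \<in> lead_coeffs R M E (terms s r n) (N n) (j, \<nu>)"
          using i(2) \<nu>(1) by (simp add: C_def)
        from lead_coeffs_shift[OF this \<nu>(2,3) H(3)[OF \<nu>(3)]]
        show "c \<in> lead_coeffs R M E (terms s r (Suc n)) H t"
          using t(1) i(1) by simp
      qed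
    qed
  qed
qed

end

end

section \<open>Submodules and the adic filtration\<close>

abbreviation (in module) adic :: "'a set \<Rightarrow> nat \<Rightarrow> 'c set" where
  "adic I n \<equiv> ideal_smult M (ideal_pow R I n) (carrier M)"

context module
begin

lemma submoduleI_smult:
  assumes "H \<subseteq> carrier M" "\<zero>\<^bsub>M\<^esub> \<in> H" "\<And>x y. \<lbrakk>x \<in> H; y \<in> H\<rbrakk> \<Longrightarrow> x \<oplus>\<^bsub>M\<^esub> y \<in> H"
    and smult: "\<And>a x. \<lbrakk>a \<in> carrier R; x \<in> H\<rbrakk> \<Longrightarrow> a \<odot>\<^bsub>M\<^esub> x \<in> H"
  shows "submodule H R M"
proof (rule submoduleI)
  fix x assume "x \<in> H"
  then have "\<ominus>\<^bsub>M\<^esub> x = (\<ominus> \<one>) \<odot>\<^bsub>M\<^esub> x" using assms(1) by (auto simp: smult_l_minus)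
  then show "\<ominus>\<^bsub>M\<^esub> x \<in> H" using smult \<open>x \<in> H\<close> by simp
qed (use assms in auto)

lemma module_span_submodule:
  assumes "e ` U \<subseteq> carrier M"
  shows "submodule (module_span R M e U) R M"
  using assms module_span_carrier[OF assms] module_span_add[OF assms] module_span_scale[OF assms]
  by (intro submoduleI_smult) (auto intro: module_span.zero)

lemma finsum_in_submodule:
  assumes "submodule H R M" "finite F" "f \<in> F \<rightarrow> H"
  shows "(\<Oplus>\<^bsub>M\<^esub>x\<in>F. f x) \<in> H"
  using assms(2,3)
proof (induction)
  case empty
  then show ?case using submodule_zero[OF assms(1)] by simp
next
  case (insert x F)
  then have "f \<in> F \<rightarrow> carrier M" "f x \<in> carrier M"
    using submoduleE(1)[OF assms(1)] by auto
  then show ?case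
    using insert submoduleE(5)[OF assms(1)] by (simp add: M.finsum_insert)
qed

lemma ideal_smult_submodule:
  assumes L: "ideal L R" and N: "submodule N R M"
  shows "submodule (ideal_smult M L N) R M"
proof (rule submoduleI_smult)
  have Lc: "L \<subseteq> carrier R" using L by (auto dest: ideal.Icarr)
  note Nc = submoduleE(1)[OF N]
  show "ideal_smult M L N \<subseteq> carrier M" using ideal_smult_closed[OF Lc Nc] by blast
  have "\<zero> \<odot>\<^bsub>M\<^esub> \<zero>\<^bsub>M\<^esub> \<in> ideal_smult M L N"
    using submodule_zero[OF N] additive_subgroup.zero_closed[OF ideal.axioms(1)[OF L]]
    by (rule ideal_smult.prod[rotated])
  then show "\<zero>\<^bsub>M\<^esub> \<in> ideal_smult M L N" by simp
  show "a \<odot>\<^bsub>M\<^esub> x \<in> ideal_smult M L N" if "a \<in> carrier R" "x \<in> ideal_smult M L N" for a x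
    using ideal_smult_left[OF that(1) Lc Nc _ that(2)] ideal.I_l_closed[OF L] that(1) by blast
qed (rule ideal_smult.sum)

lemma ideal_smult_least:
  assumes "submodule H R M" "\<And>a x. \<lbrakk>a \<in> L; x \<in> N\<rbrakk> \<Longrightarrow> a \<odot>\<^bsub>M\<^esub> x \<in> H"
  shows "ideal_smult M L N \<subseteq> H"
proof
  fix x assume "x \<in> ideal_smult M L N"
  then show "x \<in> H"
    by induction (use assms(2) submoduleE(5)[OF assms(1)] in auto)
qed

lemma module_colon_ideal:
  assumes N: "submodule N R M" and Hc: "H \<subseteq> carrier M"
  shows "ideal (module_colon R M N H) R"
proof (rule idealI)
  let ?C = "module_colon R M N H"
  show l: "x \<otimes> c \<in> ?C" if "c \<in> ?C" "x \<in> carrier R" for c x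
    using that submoduleE(4)[OF N] Hc by (auto simp: module_colon_def smult_assoc1 subset_iff)
  then show "c \<otimes> x \<in> ?C" if "c \<in> ?C" "x \<in> carrier R" for c x
    using that by (metis (no_types, lifting) m_comm mem_Collect_eq module_colon_def)
  show "subgroup ?C (add_monoid R)"
  proof (rule R.add.subgroupI)
    show "?C \<subseteq> carrier R" by (auto simp: module_colon_def)
    have "\<zero> \<in> ?C" using submodule_zero[OF N] Hc by (auto simp: module_colon_def subset_iff)
    then show "?C \<noteq> {}" by blast
    show "\<ominus> c \<in> ?C" if "c \<in> ?C" for c
      using that l[OF that, of "\<ominus> \<one>"] by (auto simp: module_colon_def l_minus)
    show "c \<oplus> d \<in> ?C" if "c \<in> ?C" "d \<in> ?C" for c d
      using that submoduleE(5)[OF N] Hc by (auto simp: module_colon_def smult_l_distr subset_iff)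
  qed
qed (rule R.ring_axioms)

context
  fixes I
  assumes I: "ideal I R"
begin

lemma adic_0: "adic I 0 = carrier M"
proof
  have *: "ideal_pow R I 0 = carrier R" by (simp add: ideals_set_def)
  show "adic I 0 \<subseteq> carrier M" unfolding * using ideal_smult_closed[of "carrier R" "carrier M"] by auto
  show "carrier M \<subseteq> adic I 0"
    unfolding * using ideal_smult.prod[of \<one> "carrier R" _ "carrier M" M] by fastforce
qed

lemma adic_submodule: "submodule (adic I n) R M"
  by (rule ideal_smult_submodule[OF ideal_pow_ideal[OF I] carrier_is_submodule])

lemma adic_carrier: "adic I n \<subseteq> carrier M"
  by (rule submoduleE(1)[OF adic_submodule])

lemma adic_Suc: "adic I (Suc n) = ideal_smult M I (adic I n)"
proof -
  have "ideal_pow R I 1 = I"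
    using monoid.nat_pow_eone[OF comm_monoid.axioms(1)[OF ideals_set_is_comm_monoid], of I] I
    by (simp add: ideals_set_def)
  then have "ideal_pow R I (Suc n) = I \<cdot> ideal_pow R I n"
    using ideal_pow_add[OF I, of 1 n] by simp
  then show ?thesis using ideal_smult_prod[OF I ideal_pow_ideal[OF I]] by simp
qed

lemma smult_adic: "\<lbrakk>a \<in> I; x \<in> adic I n\<rbrakk> \<Longrightarrow> a \<odot>\<^bsub>M\<^esub> x \<in> adic I (Suc n)"
  unfolding adic_Suc by (rule ideal_smult.prod)

lemma adic_antimono:
  assumes "m \<le> n"
  shows "adic I n \<subseteq> adic I m"
proof -
  have "adic I (Suc n) \<subseteq> adic I n" for n
    unfolding adic_Suc
    using submoduleE(4)[OF adic_submodule] ideal.Icarr[OF I]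
    by (intro ideal_smult_least[OF adic_submodule]) auto
  then show ?thesis using assms by (rule lift_Suc_antimono_le)
qed

section \<open>Stable families inside the adic filtration\<close>

text \<open>For \<open>n = 0\<close> this says that the \<open>g j\<close> generate \<open>M\<close>.  For the step, the multipliers that carry the
  degree \<open>n\<close> span into the degree \<open>n + 1\<close> span form an ideal containing the generators of \<open>I\<close>, hence
  \<open>I\<close> itself.\<close>
lemma adic_subset_term_span:
  assumes noeth: "noetherian_ring R" and fg: "module_finitely_generated R M"
  obtains r s a g where "\<And>i. i < r \<Longrightarrow> a i \<in> I" "\<And>j. j < s \<Longrightarrow> g j \<in> carrier M"
    "\<And>n. adic I n \<subseteq> module_span R M (term_value R M a g) (terms s r n)"
proof -
  obtain A where A: "A \<subseteq> carrier R" "finite A" "I = Idl A"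
    using noetherian_ring.finetely_gen[OF noeth I] by blast
  obtain as where as: "set as = A" using finite_list[OF A(2)] by blast
  obtain S where S: "finite S" "S \<subseteq> carrier M"
    "\<And>m. m \<in> carrier M \<Longrightarrow> \<exists>c\<in>S \<rightarrow> carrier R. m = (\<Oplus>\<^bsub>M\<^esub>s\<in>S. c s \<odot>\<^bsub>M\<^esub> s)"
    using fg unfolding module_finitely_generated_def by blast
  obtain gs where gs: "set gs = S" using finite_list[OF S(1)] by blast
  let ?r = "length as" and ?s = "length gs"
  let ?a = "\<lambda>i. as ! i" and ?g = "\<lambda>j. gs ! j"
  let ?E = "term_value R M ?a ?g"
  let ?S = "\<lambda>n. module_span R M ?E (terms ?s ?r n)"
  have aR: "?a i \<in> carrier R" if "i < ?r" for i using that as A(1) nth_mem by blast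
  have gM: "?g j \<in> carrier M" if "j < ?s" for j using that gs S(2) nth_mem by blast
  have E: "?E ` terms ?s ?r n \<subseteq> carrier M" for n
    using aR gM by (intro term_value_carrier)
  have sub: "submodule (?S n) R M" for n
    by (rule module_span_submodule[OF E])
  have "adic I n \<subseteq> ?S n" for n
  proof (induction n)
    case 0
    have gen: "s \<in> ?S 0" if "s \<in> S" for s
    proof -
      obtain j where j: "j < ?s" "s = ?g j" using gs \<open>s \<in> S\<close> by (metis in_set_conv_nth)
      have "?E (j, {#}) = s"
        using j gM by (simp add: term_value_def monomial_value_def)
      moreover have "(j, {#}) \<in> terms ?s ?r 0" using j by (simp add: terms_def)
      ultimately show ?thesis
        using module_span_gen[of ?E "(j, {#})" "terms ?s ?r 0" \<one>] S(2) \<open>s \<in> S\<close> by auto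
    qed
    have "m \<in> ?S 0" if m: "m \<in> carrier M" for m
    proof -
      obtain c where c: "c \<in> S \<rightarrow> carrier R" "m = (\<Oplus>\<^bsub>M\<^esub>s\<in>S. c s \<odot>\<^bsub>M\<^esub> s)" using S(3)[OF m] by blast
      have "c s \<odot>\<^bsub>M\<^esub> s \<in> ?S 0" if "s \<in> S" for s
        using funcset_mem[OF c(1) that] gen[OF that] by (rule submoduleE(4)[OF sub])
      then have "(\<lambda>s. c s \<odot>\<^bsub>M\<^esub> s) \<in> S \<rightarrow> ?S 0" by (rule funcsetI)
      then show ?thesis unfolding c(2) by (rule finsum_in_submodule[OF sub S(1)])
    qed
    then show ?case unfolding adic_0 by blast
  next
    case (Suc n)
    have "ideal (module_colon R M (?S (Suc n)) (?S n)) R"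
      by (rule module_colon_ideal[OF sub submoduleE(1)[OF sub]])
    moreover have "A \<subseteq> module_colon R M (?S (Suc n)) (?S n)"
    proof
      fix x assume x: "x \<in> A"
      then obtain i where i: "i < ?r" "x = ?a i" using as by (metis in_set_conv_nth)
      have shift: "\<exists>v\<in>terms ?s ?r (Suc n). x \<odot>\<^bsub>M\<^esub> ?E u = ?E v" if "u \<in> terms ?s ?r n" for u
      proof (cases u)
        case (Pair j \<mu>)
        have "x \<odot>\<^bsub>M\<^esub> ?E (j, \<mu>) = ?E (j, add_mset i \<mu>)"
          unfolding i(2) using aR gM that[unfolded Pair] i(1) by (rule term_value_shift)
        moreover have "(j, add_mset i \<mu>) \<in> terms ?s ?r (Suc n)"
          using that i(1) unfolding Pair by (simp add: terms_def)
        ultimately show ?thesis unfolding Pair by blast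
      qed
      have "x \<odot>\<^bsub>M\<^esub> y \<in> ?S (Suc n)" if "y \<in> ?S n" for y
        using x A(1) by (intro module_span_smult[OF E E _ shift that]) auto
      then show "x \<in> module_colon R M (?S (Suc n)) (?S n)"
        using x A(1) by (auto simp: module_colon_def)
    qed
    ultimately have "I \<subseteq> module_colon R M (?S (Suc n)) (?S n)"
      unfolding A(3) by (rule R.genideal_minimal)
    then show ?case
      unfolding adic_Suc using Suc by (intro ideal_smult_least[OF sub]) (auto simp: module_colon_def)
  qed
  moreover have "?a i \<in> I" if "i < ?r" for i
    using that as A R.genideal_self[OF A(1)] nth_mem by blast
  ultimately show thesis using that gM by blast
qed

text \<open>Finite generation of graded submodules of the Rees module, and so the source of all finiteness
  below.\<close>
lemma adic_submodules_stable:
  assumes noeth: "noetherian_ring R" and fg: "module_finitely_generated R M"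
    and N: "\<And>n. submodule (N n) R M" "\<And>n. N n \<subseteq> adic I n"
    and shift: "\<And>n a x. \<lbrakk>a \<in> I; x \<in> N n\<rbrakk> \<Longrightarrow> a \<odot>\<^bsub>M\<^esub> x \<in> N (Suc n)"
  obtains d where "\<And>n. d \<le> n \<Longrightarrow> N (Suc n) = ideal_smult M I (N n)"
proof -
  obtain r s a g where rs: "\<And>i. i < r \<Longrightarrow> a i \<in> I" "\<And>j. j < s \<Longrightarrow> g j \<in> carrier M"
    "\<And>n. adic I n \<subseteq> module_span R M (term_value R M a g) (terms s r n)"
    by (rule adic_subset_term_span[OF noeth fg]) blast
  have aR: "a i \<in> carrier R" if "i < r" for i using rs(1)[OF that] ideal.Icarr[OF I] by blast
  have "N n \<subseteq> module_span R M (term_value R M a g) (terms s r n)" for n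
    using N(2) rs(3) by blast
  from graded_submodules_stable[OF aR rs(2) noeth N(1) this shift[OF rs(1)]]
  obtain d where d: "\<And>n H. \<lbrakk>d \<le> n; submodule H R M; H \<subseteq> N (Suc n);
    \<And>i x. \<lbrakk>i < r; x \<in> N n\<rbrakk> \<Longrightarrow> a i \<odot>\<^bsub>M\<^esub> x \<in> H\<rbrakk> \<Longrightarrow> N (Suc n) = H" by blast
  show ?thesis
  proof (rule that[of d])
    fix n assume "d \<le> n"
    then show "N (Suc n) = ideal_smult M I (N n)"
      using shift rs(1) by (intro d ideal_smult_submodule[OF I N(1)] ideal_smult_least[OF N(1)])
        (auto intro: ideal_smult.prod)
  qed
qed

section \<open>Colon submodules in high degrees\<close>

text \<open>Artin-Rees for the submodule \<open>x M\<close>: the family \<open>I\<^sup>n M \<inter> x M\<close> is stable from some degree \<open>c\<close> on, so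
  that \<open>I\<^sup>n\<^sup>+\<^sup>c M \<inter> x M \<subseteq> I\<^sup>n x M\<close>, and \<open>x\<close> can be cancelled.\<close>
lemma nonzerodivisor_adic_shift:
  assumes noeth: "noetherian_ring R" and fg: "module_finitely_generated R M"
    and x: "x \<in> I" "nonzerodivisor_on R M x"
  obtains c where "\<And>n m. \<lbrakk>m \<in> carrier M; x \<odot>\<^bsub>M\<^esub> m \<in> adic I (n + c)\<rbrakk> \<Longrightarrow> m \<in> adic I n"
proof -
  have xR: "x \<in> carrier R" using x(2) by (simp add: nonzerodivisor_on_def)
  have image: "submodule ((\<odot>\<^bsub>M\<^esub>) x ` H) R M" if H: "submodule H R M" for H
  proof (rule submoduleI_smult)
    note Hc = submoduleE(1)[OF H]
    show "(\<odot>\<^bsub>M\<^esub>) x ` H \<subseteq> carrier M" using Hc xR by auto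
    show "\<zero>\<^bsub>M\<^esub> \<in> (\<odot>\<^bsub>M\<^esub>) x ` H"
      using submodule_zero[OF H] xR by (intro image_eqI[of _ _ "\<zero>\<^bsub>M\<^esub>"]) auto
    show "y \<oplus>\<^bsub>M\<^esub> z \<in> (\<odot>\<^bsub>M\<^esub>) x ` H" if "y \<in> (\<odot>\<^bsub>M\<^esub>) x ` H" "z \<in> (\<odot>\<^bsub>M\<^esub>) x ` H" for y z
      using that submoduleE(5)[OF H] Hc xR
      by (auto simp: subset_iff smult_r_distr[symmetric])
    show "a \<odot>\<^bsub>M\<^esub> y \<in> (\<odot>\<^bsub>M\<^esub>) x ` H" if "a \<in> carrier R" "y \<in> (\<odot>\<^bsub>M\<^esub>) x ` H" for a y
    proof -
      obtain z where z: "z \<in> H" "y = x \<odot>\<^bsub>M\<^esub> z" using \<open>y \<in> _\<close> by blast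
      have "a \<odot>\<^bsub>M\<^esub> y = x \<odot>\<^bsub>M\<^esub> (a \<odot>\<^bsub>M\<^esub> z)"
        using z that(1) xR Hc by (metis smult_left_commute subsetD)
      then show ?thesis using submoduleE(4)[OF H that(1) z(1)] by blast
    qed
  qed
  define N where "N n = adic I n \<inter> (\<odot>\<^bsub>M\<^esub>) x ` carrier M" for n
  note image_carrier = image[OF carrier_is_submodule]
  have N: "submodule (N n) R M" for n
    unfolding N_def
  proof (rule submoduleI_smult, goal_cases)
    case 1
    show ?case using adic_carrier by blast
  next
    case 2
    show ?case using submodule_zero[OF adic_submodule] submodule_zero[OF image_carrier] by (rule IntI)
  next
    case (3 y z)
    then show ?case
      by (intro IntI submoduleE(5)[OF adic_submodule] submoduleE(5)[OF image_carrier]; elim IntE)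
  next
    case (4 b y)
    then show ?case
      by (intro IntI submoduleE(4)[OF adic_submodule] submoduleE(4)[OF image_carrier]; elim IntE)
  qed
  have shift: "a \<odot>\<^bsub>M\<^esub> y \<in> N (Suc n)" if "a \<in> I" "y \<in> N n" for n a y
    using that smult_adic submoduleE(4)[OF image_carrier] ideal.Icarr[OF I] unfolding N_def by blast
  have "N n \<subseteq> adic I n" for n by (auto simp: N_def)
  from adic_submodules_stable[OF noeth fg N this shift]
  obtain c where c: "\<And>n. c \<le> n \<Longrightarrow> N (Suc n) = ideal_smult M I (N n)" by blast
  have sub: "N (n + c) \<subseteq> (\<odot>\<^bsub>M\<^esub>) x ` adic I n" for n
  proof (induction n)
    case 0
    show ?case unfolding adic_0 N_def by blast
  next
    case (Suc n)
    have "ideal_smult M I (N (n + c)) \<subseteq> (\<odot>\<^bsub>M\<^esub>) x ` adic I (Suc n)"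
    proof (rule ideal_smult_least[OF image[OF adic_submodule]])
      fix a y assume a: "a \<in> I" and "y \<in> N (n + c)"
      then obtain z where z: "z \<in> adic I n" "y = x \<odot>\<^bsub>M\<^esub> z" using Suc by blast
      have "a \<odot>\<^bsub>M\<^esub> y = x \<odot>\<^bsub>M\<^esub> (a \<odot>\<^bsub>M\<^esub> z)"
        using z a xR adic_carrier ideal.Icarr[OF I] by (metis smult_left_commute subsetD)
      then show "a \<odot>\<^bsub>M\<^esub> y \<in> (\<odot>\<^bsub>M\<^esub>) x ` adic I (Suc n)"
        using smult_adic[OF a z(1)] by blast
    qed
    then show ?case using c[of "n + c"] by simp
  qed
  show ?thesis
  proof (rule that[of c])
    fix n m assume m: "m \<in> carrier M" "x \<odot>\<^bsub>M\<^esub> m \<in> adic I (n + c)"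
    then have "x \<odot>\<^bsub>M\<^esub> m \<in> N (n + c)" by (simp add: N_def)
    then obtain z where z: "z \<in> adic I n" "x \<odot>\<^bsub>M\<^esub> m = x \<odot>\<^bsub>M\<^esub> z" using sub by blast
    have zM: "z \<in> carrier M" using z adic_carrier by blast
    have "x \<odot>\<^bsub>M\<^esub> (m \<ominus>\<^bsub>M\<^esub> z) = \<zero>\<^bsub>M\<^esub>"
      using z(2) m(1) zM xR by (simp add: M.minus_eq smult_r_distr smult_r_minus M.r_neg)
    then have "m \<ominus>\<^bsub>M\<^esub> z = \<zero>\<^bsub>M\<^esub>"
      using x(2) m(1) zM by (simp add: nonzerodivisor_on_def)
    moreover have "m = (m \<ominus>\<^bsub>M\<^esub> z) \<oplus>\<^bsub>M\<^esub> z"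
      using m(1) zM by (simp add: M.minus_eq M.a_assoc M.l_neg)
    ultimately have "m = z" using zM by simp
    then show "m \<in> adic I n" using z(1) by simp
  qed
qed

text \<open>The elements in question represent the part of the associated graded module killed by \<open>I/I\<^sup>2\<close>.
  If the family is stable at \<open>n\<close>, its member \<open>m\<close> in degree \<open>n + 1\<close> is a combination with coefficients
  in \<open>I\<close> of members in degree \<open>n\<close>, which \<open>I\<close> multiplies into \<open>I\<^sup>n\<^sup>+\<^sup>2 M\<close>.\<close>
lemma adic_socle_eventually_zero:
  assumes noeth: "noetherian_ring R" and fg: "module_finitely_generated R M"
  obtains d where "\<And>n m. \<lbrakk>d \<le> n; m \<in> adic I n; \<And>a. a \<in> I \<Longrightarrow> a \<odot>\<^bsub>M\<^esub> m \<in> adic I (n + 2)\<rbrakk>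
    \<Longrightarrow> m \<in> adic I (Suc n)"
proof -
  define N where "N n = {m \<in> adic I n. \<forall>a\<in>I. a \<odot>\<^bsub>M\<^esub> m \<in> adic I (n + 2)}" for n
  have IR: "a \<in> carrier R" if "a \<in> I" for a using that ideal.Icarr[OF I] by blast
  have N: "submodule (N n) R M" for n
  proof (rule submoduleI_smult)
    show "N n \<subseteq> carrier M" using adic_carrier by (auto simp: N_def)
    show "\<zero>\<^bsub>M\<^esub> \<in> N n"
      using submodule_zero[OF adic_submodule] IR by (simp add: N_def del: add_2_eq_Suc')
    show "y \<oplus>\<^bsub>M\<^esub> z \<in> N n" if "y \<in> N n" "z \<in> N n" for y z
    proof -
      have "y \<in> carrier M" "z \<in> carrier M" using that adic_carrier by (auto simp: N_def)
      then show ?thesis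
        using that submoduleE(5)[OF adic_submodule] IR by (simp add: N_def smult_r_distr del: add_2_eq_Suc')
    qed
    show "b \<odot>\<^bsub>M\<^esub> y \<in> N n" if "b \<in> carrier R" "y \<in> N n" for b y
    proof -
      have "y \<in> carrier M" using that adic_carrier by (auto simp: N_def)
      then show ?thesis
        using that submoduleE(4)[OF adic_submodule] IR smult_left_commute[of _ b y] by (simp add: N_def del: add_2_eq_Suc')
    qed
  qed
  have shift: "a \<odot>\<^bsub>M\<^esub> y \<in> N (Suc n)" if "a \<in> I" "y \<in> N n" for n a y
    using that smult_adic[of _ y n] smult_adic[of _ "a \<odot>\<^bsub>M\<^esub> y" "Suc (Suc n)"] by (auto simp: N_def)
  have "N n \<subseteq> adic I n" for n by (auto simp: N_def)
  from adic_submodules_stable[OF noeth fg N this shift]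
  obtain d where d: "\<And>n. d \<le> n \<Longrightarrow> N (Suc n) = ideal_smult M I (N n)" by blast
  show ?thesis
  proof (rule that[of "Suc d"])
    fix n m assume n: "Suc d \<le> n" and m: "m \<in> adic I n" "\<And>a. a \<in> I \<Longrightarrow> a \<odot>\<^bsub>M\<^esub> m \<in> adic I (n + 2)"
    then obtain k where k: "n = Suc k" "d \<le> k" by (cases n) auto
    have "m \<in> ideal_smult M I (N k)" using m d[OF k(2)] unfolding k(1) N_def by auto
    moreover have "ideal_smult M I (N k) \<subseteq> adic I (Suc n)"
      by (rule ideal_smult_least[OF adic_submodule]) (auto simp: N_def k(1))
    ultimately show "m \<in> adic I (Suc n)" by blast
  qed
qed

text \<open>The nonzerodivisor places \<open>m\<close> in \<open>I\<^sup>e M\<close>, where \<open>e\<close> is a degree from which on the associated graded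
  module has no socle.  As long as the known power is below \<open>n\<close>, the product \<open>I m\<close> lies two powers
  above it, and the absence of a socle raises it by one.\<close>
lemma adic_colon_eventually:
  assumes noeth: "noetherian_ring R" and fg: "module_finitely_generated R M"
    and grade: "grade_pos R I M"
  obtains d where "\<And>n m. \<lbrakk>d \<le> n; m \<in> carrier M; \<And>a. a \<in> I \<Longrightarrow> a \<odot>\<^bsub>M\<^esub> m \<in> adic I (Suc n)\<rbrakk>
    \<Longrightarrow> m \<in> adic I n"
proof -
  obtain x where x: "x \<in> I" "nonzerodivisor_on R M x" using grade by (auto simp: grade_pos_def)
  obtain c where c: "\<And>n m. \<lbrakk>m \<in> carrier M; x \<odot>\<^bsub>M\<^esub> m \<in> adic I (n + c)\<rbrakk> \<Longrightarrow> m \<in> adic I n"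
    by (rule nonzerodivisor_adic_shift[OF noeth fg x]) blast
  obtain e where e: "\<And>n m. \<lbrakk>e \<le> n; m \<in> adic I n; \<And>a. a \<in> I \<Longrightarrow> a \<odot>\<^bsub>M\<^esub> m \<in> adic I (n + 2)\<rbrakk>
    \<Longrightarrow> m \<in> adic I (Suc n)"
    by (rule adic_socle_eventually_zero[OF noeth fg]) blast
  show ?thesis
  proof (rule that[of "c + e"])
    fix n m assume n: "c + e \<le> n" and m: "m \<in> carrier M" "\<And>a. a \<in> I \<Longrightarrow> a \<odot>\<^bsub>M\<^esub> m \<in> adic I (Suc n)"
    have "m \<in> adic I (e + k)" if "e + k \<le> n" for k
      using that
    proof (induction k)
      case 0
      have "x \<odot>\<^bsub>M\<^esub> m \<in> adic I (e + c)"
        using m(2)[OF x(1)] adic_antimono[of "e + c" "Suc n"] n by auto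
      then show ?case using c[OF m(1)] by simp
    next
      case (Suc k)
      have "a \<odot>\<^bsub>M\<^esub> m \<in> adic I (e + k + 2)" if "a \<in> I" for a
        using m(2)[OF that] adic_antimono[of "e + k + 2" "Suc n"] Suc.prems by auto
      then show ?case using e[of "e + k" m] Suc by simp
    qed
    from this[of "n - e"] n show "m \<in> adic I n" by simp
  qed
qed

text \<open>The bound \<open>d\<close> is independent of \<open>k\<close>, so it applies to the whole union that defines \<open>r(I\<^sup>n, M)\<close>.  The
  exponent \<open>k\<close> is lowered to \<open>0\<close> one step at a time.\<close>
lemma colon_adic_smult_eventually:
  assumes noeth: "noetherian_ring R" and fg: "module_finitely_generated R M"
    and grade: "grade_pos R I M"
  obtains d where "\<And>n k a m. \<lbrakk>d \<le> n; a \<in> module_colon R M (adic I (n + k)) (adic I k); m \<in> carrier M\<rbrakk>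
    \<Longrightarrow> a \<odot>\<^bsub>M\<^esub> m \<in> adic I n"
proof -
  obtain d where d: "\<And>n m. \<lbrakk>d \<le> n; m \<in> carrier M; \<And>a. a \<in> I \<Longrightarrow> a \<odot>\<^bsub>M\<^esub> m \<in> adic I (Suc n)\<rbrakk>
    \<Longrightarrow> m \<in> adic I n"
    by (rule adic_colon_eventually[OF noeth fg grade]) blast
  have "module_colon R M (adic I (n + k)) (adic I k) \<subseteq> module_colon R M (adic I n) (carrier M)"
    if n: "d \<le> n" for n k
  proof (induction k)
    case 0
    show ?case by (simp only: adic_0 add_0_right order_refl)
  next
    case (Suc k)
    have "module_colon R M (adic I (n + Suc k)) (adic I (Suc k)) \<subseteq> module_colon R M (adic I (n + k)) (adic I k)"
    proof
      fix a assume a: "a \<in> module_colon R M (adic I (n + Suc k)) (adic I (Suc k))"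
      then have aR: "a \<in> carrier R" by (simp add: module_colon_def)
      have "a \<odot>\<^bsub>M\<^esub> m \<in> adic I (n + k)" if m: "m \<in> adic I k" for m
      proof (rule d)
        have mM: "m \<in> carrier M" using m adic_carrier by blast
        then show "a \<odot>\<^bsub>M\<^esub> m \<in> carrier M" using aR by simp
        fix b assume b: "b \<in> I"
        have "a \<odot>\<^bsub>M\<^esub> (b \<odot>\<^bsub>M\<^esub> m) \<in> adic I (n + Suc k)"
          using a smult_adic[OF b m] by (auto simp: module_colon_def)
        moreover have "a \<odot>\<^bsub>M\<^esub> (b \<odot>\<^bsub>M\<^esub> m) = b \<odot>\<^bsub>M\<^esub> (a \<odot>\<^bsub>M\<^esub> m)"
          using aR ideal.Icarr[OF I b] mM by (metis smult_left_commute)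
        ultimately show "b \<odot>\<^bsub>M\<^esub> (a \<odot>\<^bsub>M\<^esub> m) \<in> adic I (Suc (n + k))" by simp
      qed (use n in simp)
      then show "a \<in> module_colon R M (adic I (n + k)) (adic I k)"
        using aR by (simp add: module_colon_def)
    qed
    with Suc show ?case by blast
  qed
  then show ?thesis by (intro that[of d]) (simp only: module_colon_def subset_iff mem_Collect_eq, blast)
qed

end

end

context module
begin

section \<open>Filtrations of ideals acting on a faithful module\<close>

lemma ideal_image_submodule:
  assumes J: "ideal J R" and m: "m \<in> carrier M"
  shows "submodule ((\<lambda>b. b \<odot>\<^bsub>M\<^esub> m) ` J) R M"
proof (rule submoduleI_smult)
  let ?H = "(\<lambda>b. b \<odot>\<^bsub>M\<^esub> m) ` J"
  have JR: "b \<in> carrier R" if "b \<in> J" for b using that ideal.Icarr[OF J] by blast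
  show "?H \<subseteq> carrier M" using JR m by auto
  show "\<zero>\<^bsub>M\<^esub> \<in> ?H"
    using additive_subgroup.zero_closed[OF ideal.axioms(1)[OF J]] m
    by (intro image_eqI[of _ _ \<zero>]) auto
  show "x \<oplus>\<^bsub>M\<^esub> y \<in> ?H" if xy: "x \<in> ?H" "y \<in> ?H" for x y
  proof -
    obtain b c where "b \<in> J" "x = b \<odot>\<^bsub>M\<^esub> m" "c \<in> J" "y = c \<odot>\<^bsub>M\<^esub> m" using xy by blast
    then show ?thesis
      using additive_subgroup.a_closed[OF ideal.axioms(1)[OF J], of b c] JR m
      by (intro image_eqI[of _ _ "b \<oplus> c"]) (auto simp: smult_l_distr)
  qed
  show "a \<odot>\<^bsub>M\<^esub> x \<in> ?H" if "a \<in> carrier R" "x \<in> ?H" for a x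
  proof -
    obtain b where "b \<in> J" "x = b \<odot>\<^bsub>M\<^esub> m" using \<open>x \<in> ?H\<close> by blast
    then show ?thesis
      using ideal.I_l_closed[OF J, of b a] JR m that(1)
      by (intro image_eqI[of _ _ "a \<otimes> b"]) (auto simp: smult_assoc1)
  qed
qed

lemma ideal_smult_image:
  assumes I: "ideal I R" and J: "ideal J R" and m: "m \<in> carrier M"
    and x: "x \<in> ideal_smult M I ((\<lambda>b. b \<odot>\<^bsub>M\<^esub> m) ` J)"
  shows "\<exists>c\<in>I \<cdot> J. x = c \<odot>\<^bsub>M\<^esub> m"
  using x
proof induction
  case (prod a y)
  then obtain b where b: "b \<in> J" "y = b \<odot>\<^bsub>M\<^esub> m" by blast
  have "a \<odot>\<^bsub>M\<^esub> y = (a \<otimes> b) \<odot>\<^bsub>M\<^esub> m"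
    using b prod(1) ideal.Icarr[OF I] ideal.Icarr[OF J] m by (simp add: smult_assoc1)
  then show ?case using ideal_prod.prod[OF prod(1) b(1)] by blast
next
  case (sum y z)
  then obtain c d where "c \<in> I \<cdot> J" "y = c \<odot>\<^bsub>M\<^esub> m" "d \<in> I \<cdot> J" "z = d \<odot>\<^bsub>M\<^esub> m" by blast
  moreover from this have "c \<in> carrier R" "d \<in> carrier R"
    using R.ideal_prod_in_carrier[OF I J] by blast+
  ultimately show ?case
    using ideal_prod.sum[of c R I J d] m by (intro bexI[of _ "c \<oplus> d"]) (auto simp: smult_l_distr)
qed

lemma annihilator_of_generators:
  assumes a: "a \<in> carrier R" and S: "finite S" "S \<subseteq> carrier M" "\<And>m. m \<in> S \<Longrightarrow> a \<odot>\<^bsub>M\<^esub> m = \<zero>\<^bsub>M\<^esub>"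
    and gen: "\<And>m. m \<in> carrier M \<Longrightarrow> \<exists>c\<in>S \<rightarrow> carrier R. m = (\<Oplus>\<^bsub>M\<^esub>s\<in>S. c s \<odot>\<^bsub>M\<^esub> s)"
  shows "a \<in> module_annihilator R M"
proof -
  define H where "H = {x \<in> carrier M. a \<odot>\<^bsub>M\<^esub> x = \<zero>\<^bsub>M\<^esub>}"
  have H: "submodule H R M"
  proof (rule submoduleI_smult)
    show "b \<odot>\<^bsub>M\<^esub> x \<in> H" if "b \<in> carrier R" "x \<in> H" for b x
    proof -
      have "x \<in> carrier M" "a \<odot>\<^bsub>M\<^esub> x = \<zero>\<^bsub>M\<^esub>" using that by (auto simp: H_def)
      then show ?thesis using that(1) a smult_left_commute[of a b x] by (simp add: H_def)
    qed
  qed (use a in \<open>auto simp: H_def smult_r_distr\<close>)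
  have "m \<in> H" if m: "m \<in> carrier M" for m
  proof -
    obtain c where c: "c \<in> S \<rightarrow> carrier R" "m = (\<Oplus>\<^bsub>M\<^esub>s\<in>S. c s \<odot>\<^bsub>M\<^esub> s)" using gen[OF m] by blast
    have "c s \<odot>\<^bsub>M\<^esub> s \<in> H" if "s \<in> S" for s
      using submoduleE(4)[OF H funcset_mem[OF c(1) that], of s] that S by (auto simp: H_def)
    then show ?thesis unfolding c(2) by (intro finsum_in_submodule[OF H S(1)] funcsetI)
  qed
  then show ?thesis using a by (auto simp: module_annihilator_def H_def)
qed

text \<open>Induction over the elements of \<open>F\<close>, correcting one coordinate at a time.  Once \<open>b \<ominus> c\<close> kills \<open>F\<close>, the
  multiples of a further \<open>m\<close> by those elements of \<open>G\<^sub>n\<close> that kill \<open>F\<close> form a stable family, so that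
  \<open>(b \<ominus> c) m = c' m\<close> for some \<open>c'\<close> in \<open>I G\<^sub>n\<close> that kills \<open>F\<close> as well.  Subtracting \<open>c'\<close> leaves the
  earlier coordinates zero.\<close>
lemma ideal_filtration_stable_mod_annihilator:
  assumes noeth: "noetherian_ring R" and fg: "module_finitely_generated R M" and I: "ideal I R"
    and G: "\<And>n. ideal (G n) R" "\<And>n. I \<cdot> G n \<subseteq> G (Suc n)"
    and GM: "\<And>n b m. \<lbrakk>b \<in> G n; m \<in> carrier M\<rbrakk> \<Longrightarrow> b \<odot>\<^bsub>M\<^esub> m \<in> adic I n"
    and F: "finite F" "F \<subseteq> carrier M"
  shows "\<exists>d. \<forall>n\<ge>d. \<forall>b\<in>G (Suc n). \<exists>c\<in>I \<cdot> G n. b \<ominus> c \<in> module_colon R M {\<zero>\<^bsub>M\<^esub>} F"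
  using F
proof (induction F)
  case empty
  have "\<zero> \<in> I \<cdot> G n" for n
    using R.ideal_prod_is_ideal[OF I G(1)] additive_subgroup.zero_closed ideal.axioms(1) by blast
  moreover have "b \<ominus> \<zero> \<in> module_colon R M {\<zero>\<^bsub>M\<^esub>} {}" if "b \<in> G (Suc n)" for b n
    using ideal.Icarr[OF G(1) that] by (simp add: module_colon_def)
  ultimately show ?case by blast
next
  case (insert m F)
  let ?K = "module_colon R M {\<zero>\<^bsub>M\<^esub>} F"
  have m: "m \<in> carrier M" and F: "F \<subseteq> carrier M" using insert by auto
  have "submodule {\<zero>\<^bsub>M\<^esub>} R M" by (rule submoduleI_smult) auto
  then have K: "ideal ?K R" using F by (rule module_colon_ideal)
  define J where "J n = G n \<inter> ?K" for n
  have J: "ideal (J n) R" for n unfolding J_def by (rule R.i_intersect[OF G(1) K])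
  define N where "N n = (\<lambda>b. b \<odot>\<^bsub>M\<^esub> m) ` J n" for n
  have N: "submodule (N n) R M" for n unfolding N_def by (rule ideal_image_submodule[OF J m])
  have Nadic: "N n \<subseteq> adic I n" for n using GM m by (auto simp: N_def J_def)
  have shift: "a \<odot>\<^bsub>M\<^esub> x \<in> N (Suc n)" if a: "a \<in> I" and x: "x \<in> N n" for n a x
  proof -
    obtain b where b: "b \<in> J n" "x = b \<odot>\<^bsub>M\<^esub> m" using x by (auto simp: N_def)
    have R: "a \<in> carrier R" "b \<in> carrier R" using a b ideal.Icarr[OF I] ideal.Icarr[OF J] by auto
    have "a \<otimes> b \<in> J (Suc n)"
      using b a G(2) ideal_prod.prod[of a I b "G n" R] ideal.I_l_closed[OF K] R by (auto simp: J_def)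
    then show ?thesis using R b(2) m by (auto simp: N_def smult_assoc1[symmetric])
  qed
  obtain d where d: "\<And>n. d \<le> n \<Longrightarrow> N (Suc n) = ideal_smult M I (N n)"
    by (rule adic_submodules_stable[OF I noeth fg N Nadic shift]) blast+
  obtain e where e: "\<And>n b. \<lbrakk>e \<le> n; b \<in> G (Suc n)\<rbrakk> \<Longrightarrow> \<exists>c\<in>I \<cdot> G n. b \<ominus> c \<in> ?K"
    using insert.IH F by blast
  have "\<exists>c\<in>I \<cdot> G n. b \<ominus> c \<in> module_colon R M {\<zero>\<^bsub>M\<^esub>} (insert m F)"
    if n: "max d e \<le> n" and b: "b \<in> G (Suc n)" for n b
  proof -
    obtain c where c: "c \<in> I \<cdot> G n" "b \<ominus> c \<in> ?K" using e n b by auto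
    have "c \<in> G (Suc n)" using c(1) G(2) by blast
    then have "b \<ominus> c \<in> G (Suc n)"
      using b G(1)[of "Suc n"] by (metis R.minus_eq additive_subgroup.a_closed
        additive_subgroup.a_inv_closed ideal.axioms(1))
    then have "(b \<ominus> c) \<odot>\<^bsub>M\<^esub> m \<in> N (Suc n)" using c(2) by (auto simp: N_def J_def)
    then obtain c' where c': "c' \<in> I \<cdot> J n" "(b \<ominus> c) \<odot>\<^bsub>M\<^esub> m = c' \<odot>\<^bsub>M\<^esub> m"
      using d[of n] n ideal_smult_image[OF I J m, of "(b \<ominus> c) \<odot>\<^bsub>M\<^esub> m" n] unfolding N_def by auto
    have "I \<cdot> J n \<subseteq> I \<cdot> G n"
    proof
      fix x assume "x \<in> I \<cdot> J n"
      then show "x \<in> I \<cdot> G n"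
        by induction (auto simp: J_def intro: ideal_prod.intros)
    qed
    then have c'G: "c' \<in> I \<cdot> G n" using c'(1) by blast
    have c'K: "c' \<in> ?K" using c'(1) R.ideal_prod_inter[OF I J] by (auto simp: J_def)
    have R: "b \<in> carrier R" "c \<in> carrier R" "c' \<in> carrier R"
      using b c(1) c'G ideal.Icarr[OF G(1)] R.ideal_prod_in_carrier[OF I G(1)] by blast+
    have sum: "b \<ominus> (c \<oplus> c') = (b \<ominus> c) \<ominus> c'"
      using R by (simp add: R.minus_eq R.minus_add R.a_assoc)
    have "(b \<ominus> (c \<oplus> c')) \<odot>\<^bsub>M\<^esub> m = \<zero>\<^bsub>M\<^esub>"
      unfolding sum R.minus_eq[of "b \<ominus> c"] using R m c'(2)
      by (simp add: smult_l_distr smult_l_minus M.r_neg)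
    moreover have "b \<ominus> (c \<oplus> c') \<in> ?K"
      unfolding sum using c(2) c'K K by (metis R.minus_eq additive_subgroup.a_closed
        additive_subgroup.a_inv_closed ideal.axioms(1))
    ultimately have "b \<ominus> (c \<oplus> c') \<in> module_colon R M {\<zero>\<^bsub>M\<^esub>} (insert m F)"
      by (simp add: module_colon_def)
    then show ?thesis using ideal_prod.sum[OF c(1) c'G] by blast
  qed
  then show ?case by blast
qed

lemma ideal_filtration_stable_if_faithful:
  assumes noeth: "noetherian_ring R" and fg: "module_finitely_generated R M" and I: "ideal I R"
    and faithful: "module_annihilator R M = {\<zero>}"
    and G: "\<And>n. ideal (G n) R" "\<And>n. I \<cdot> G n \<subseteq> G (Suc n)"
    and GM: "\<And>n b m. \<lbrakk>b \<in> G n; m \<in> carrier M\<rbrakk> \<Longrightarrow> b \<odot>\<^bsub>M\<^esub> m \<in> adic I n"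
  obtains d where "\<And>n. d \<le> n \<Longrightarrow> I \<cdot> G n = G (Suc n)"
proof -
  obtain S where S: "finite S" "S \<subseteq> carrier M"
    "\<And>m. m \<in> carrier M \<Longrightarrow> \<exists>c\<in>S \<rightarrow> carrier R. m = (\<Oplus>\<^bsub>M\<^esub>s\<in>S. c s \<odot>\<^bsub>M\<^esub> s)"
    using fg unfolding module_finitely_generated_def by blast
  obtain d where d: "\<And>n b. \<lbrakk>d \<le> n; b \<in> G (Suc n)\<rbrakk>
    \<Longrightarrow> \<exists>c\<in>I \<cdot> G n. b \<ominus> c \<in> module_colon R M {\<zero>\<^bsub>M\<^esub>} S"
    using ideal_filtration_stable_mod_annihilator[where G = G, OF noeth fg I G GM S(1,2)] by blast
  show ?thesis
  proof (rule that[of d], rule antisym)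
    fix n assume n: "d \<le> n"
    show "G (Suc n) \<subseteq> I \<cdot> G n"
    proof
      fix b assume b: "b \<in> G (Suc n)"
      then obtain c where c: "c \<in> I \<cdot> G n" "b \<ominus> c \<in> module_colon R M {\<zero>\<^bsub>M\<^esub>} S"
        using d[OF n] by blast
      then have "b \<ominus> c \<in> module_annihilator R M"
        by (intro annihilator_of_generators[OF _ S(1,2) _ S(3)]) (auto simp: module_colon_def)
      then have "b \<ominus> c = \<zero>" using faithful by simp
      moreover have "b \<in> carrier R" "c \<in> carrier R"
        using b c(1) ideal.Icarr[OF G(1)] R.ideal_prod_in_carrier[OF I G(1)] by blast+
      ultimately show "b \<in> I \<cdot> G n" using c(1) by (simp add: R.r_right_minus_eq)
    qed
  qed (rule G(2))
qed

section \<open>The Ratliff-Rush filtration\<close>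

text \<open>A description uniform in \<open>n\<close>: for \<open>n = 0\<close> every colon ideal in the union is the whole ring.\<close>
lemma ratliff_rush_pow_adic:
  assumes I: "ideal I R"
  shows "ratliff_rush R M (ideal_pow R I n) = (\<Union>k\<in>{1..}. module_colon R M (adic I (n + k)) (adic I k))"
proof (cases "n = 0")
  case True
  have "module_colon R M (adic I k) (adic I k) = carrier R" for k
    using submoduleE(4)[OF adic_submodule[OF I]] by (auto simp: module_colon_def)
  then show ?thesis unfolding True ratliff_rush_pow_0[OF I] add_0 by auto
qed (use ratliff_rush_pow[OF I, of n] in simp)

lemma ratliff_rush_pow_ideal:
  assumes I: "ideal I R"
  shows "ideal (ratliff_rush R M (ideal_pow R I n)) R"
proof -
  define C where "C k = module_colon R M (adic I (n + k)) (adic I k)" for k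
  have C: "ideal (C k) R" for k
    unfolding C_def by (rule module_colon_ideal[OF adic_submodule[OF I] adic_carrier[OF I]])
  have mono: "C k \<subseteq> C l" if "k \<le> l" for k l
    unfolding C_def by (rule module_colon_pow_mono[OF I that])
  have "subset.chain {J. ideal J R} (C ` {1..})"
    unfolding subset.chain_def using C
    by (auto simp: psubset_eq) (metis linorder_linear mono subsetD)+
  from R.chain_Union_is_ideal[OF this] show ?thesis
    unfolding ratliff_rush_pow_adic[OF I] C_def by (simp add: image_is_empty)
qed

lemma ratliff_rush_pow_Suc_subset:
  assumes I: "ideal I R"
  shows "ratliff_rush R M (ideal_pow R I (Suc n)) \<subseteq> ratliff_rush R M (ideal_pow R I n)"
proof -
  have "adic I (Suc n + k) \<subseteq> adic I (n + k)" for k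
    by (rule adic_antimono[OF I]) simp
  then have "module_colon R M (adic I (Suc n + k)) (adic I k) \<subseteq> module_colon R M (adic I (n + k)) (adic I k)" for k
    unfolding module_colon_def by blast
  then show ?thesis unfolding ratliff_rush_pow_adic[OF I] by (rule UN_mono[OF subset_refl])
qed

lemma ideal_prod_ratliff_rush_pow:
  assumes I: "ideal I R"
  shows "I \<cdot> ratliff_rush R M (ideal_pow R I n) \<subseteq> ratliff_rush R M (ideal_pow R I (Suc n))"
proof
  fix x assume "x \<in> I \<cdot> ratliff_rush R M (ideal_pow R I n)"
  then show "x \<in> ratliff_rush R M (ideal_pow R I (Suc n))"
  proof induction
    case (prod a b)
    then obtain k where k: "k \<ge> 1" "b \<in> module_colon R M (adic I (n + k)) (adic I k)"
      unfolding ratliff_rush_pow_adic[OF I] by blast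
    have R: "a \<in> carrier R" "b \<in> carrier R"
      using ideal.Icarr[OF I prod(1)] k(2) by (simp_all add: module_colon_def)
    have "(a \<otimes> b) \<odot>\<^bsub>M\<^esub> m \<in> adic I (Suc n + k)" if m: "m \<in> adic I k" for m
    proof -
      have "m \<in> carrier M" using m adic_carrier[OF I] by blast
      then have "(a \<otimes> b) \<odot>\<^bsub>M\<^esub> m = a \<odot>\<^bsub>M\<^esub> (b \<odot>\<^bsub>M\<^esub> m)" using R by (simp add: smult_assoc1)
      moreover have "b \<odot>\<^bsub>M\<^esub> m \<in> adic I (n + k)"
        using k(2) m by (simp only: module_colon_def mem_Collect_eq)
      ultimately show ?thesis using smult_adic[OF I prod(1)] by (metis add_Suc)
    qed
    then have "a \<otimes> b \<in> module_colon R M (adic I (Suc n + k)) (adic I k)"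
      using R by (simp only: module_colon_def mem_Collect_eq) simp
    then show ?case unfolding ratliff_rush_pow_adic[OF I] using k(1) by blast
  next
    case (sum x y)
    then show ?case
      using additive_subgroup.a_closed[OF ideal.axioms(1)[OF ratliff_rush_pow_ideal[OF I]]] by blast
  qed
qed

end

theorem theorem5p3:
  fixes R :: "('a, 'r) ring_scheme"
    and M :: "('a, 'b, 'm) module_scheme"
    and I :: "'a set"
  assumes "noetherian_ring R"
    and "module R M"
    and "ideal I R"
    and "module_finitely_generated R M"
    and "grade_pos R I M"
    and "module_annihilator R M = {\<zero>\<^bsub>R\<^esub>}"
  shows "stable_filtration R I (\<lambda>n. ratliff_rush R M (ideal_pow R I n))"
proof -
  interpret module R M by fact
  note noeth = assms(1) and I = assms(3) and fg = assms(4)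
  let ?F = "\<lambda>n. ratliff_rush R M (ideal_pow R I n)"
  obtain d where d: "\<And>n k a m. \<lbrakk>d \<le> n; a \<in> module_colon R M (adic I (n + k)) (adic I k);
      m \<in> carrier M\<rbrakk> \<Longrightarrow> a \<odot>\<^bsub>M\<^esub> m \<in> adic I n"
    by (rule colon_adic_smult_eventually[OF I noeth fg assms(5)]) blast
  \<comment> \<open>The inclusion \<open>F\<^sub>n M \<subseteq> I\<^sup>n M\<close> may fail in low degrees, so the filtration is truncated there.\<close>
  define G where "G n = (if d \<le> n then ?F n else {\<zero>\<^bsub>R\<^esub>})" for n
  have G: "ideal (G n) R" for n
    using ratliff_rush_pow_ideal[OF I] R.zeroideal by (simp only: G_def split: if_split) blast
  have "I \<cdot>\<^bsub>R\<^esub> G n \<subseteq> G (Suc n)" for n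
  proof (cases "d \<le> n")
    case True
    then show ?thesis using ideal_prod_ratliff_rush_pow[OF I, of n] by (simp only: G_def le_SucI if_True)
  next
    case False
    then have "I \<cdot>\<^bsub>R\<^esub> G n \<subseteq> {\<zero>\<^bsub>R\<^esub>}"
      using R.ideal_prod_inter[OF I R.zeroideal] by (simp add: G_def)
    moreover have "\<zero>\<^bsub>R\<^esub> \<in> G (Suc n)"
      using additive_subgroup.zero_closed[OF ideal.axioms(1)[OF G]] .
    ultimately show ?thesis by blast
  qed
  moreover have "b \<odot>\<^bsub>M\<^esub> m \<in> adic I n" if b: "b \<in> G n" and m: "m \<in> carrier M" for n b m
  proof (cases "d \<le> n")
    case True
    then show ?thesis
      using b d[OF True _ m] unfolding G_def if_P[OF True] ratliff_rush_pow_adic[OF I] by blast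
  next
    case False
    then show ?thesis using b m submodule_zero[OF adic_submodule[OF I]] by (simp add: G_def)
  qed
  ultimately obtain e where e: "\<And>n. e \<le> n \<Longrightarrow> I \<cdot>\<^bsub>R\<^esub> G n = G (Suc n)"
    by (rule ideal_filtration_stable_if_faithful[OF noeth fg I assms(6) G]) blast+
  have "I \<cdot>\<^bsub>R\<^esub> ?F n = ?F (Suc n)" if "max d e \<le> n" for n
    using e[of n] that by (simp only: G_def max.bounded_iff le_SucI if_True)
  then have "\<forall>\<^sub>F n in sequentially. I \<cdot>\<^bsub>R\<^esub> ?F n = ?F (Suc n)"
    unfolding eventually_sequentially by blast
  then show ?thesis
    unfolding stable_filtration_def ideal_filtration_def
    using ratliff_rush_pow_0[OF I] ratliff_rush_pow_ideal[OF I] ratliff_rush_pow_Suc_subset[OF I]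
      ideal_prod_ratliff_rush_pow[OF I] by blast
qed

end
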